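(* Let $b>0$ and $S(\omega)=e^{-b\omega^2}$, $\omega\in\mathbb{R}$. Then the first intensity of the zeros of the spectrogram of stationary, circularly symmetric generalized complex Gaussian noise with power spectral density (PSD) $S$ is $$\rho_{1,\mathrm{Spec}}(\tau,\omega)=\frac{2\pi}{2\pi+b},\qquad(\tau,\omega)\in\mathbb{R}^2.$$
   Context: Smoothed PSD: $S_\phi(\omega)=\int_{-\infty}^\infty e^{-2\pi(t-\omega)^2}S(t)\,dt$. First intensity: for pure noise $\mathcal{W}_S$, the first intensity function of the spectrogram zeros is $$\rho_{1,\mathrm{Spec}}(\tau,\omega)=1+\tfrac{1}{4\pi}(\log S_\phi)''(\omega),\qquad(\tau,\omega)\in\mathbb{R}^2;$$ it is the function whose integral over any Borel set $\Omega\subset\mathbb{R}^2$ is the expected number of points $(\tau,\omega)\in\Omega$ with $\mathrm{Spec}_{\mathcal{W}_S}(\tau,\omega)=0$, where $\mathrm{Spec}_{g}=|V_\varphi g|^2$, $V_\varphi g(x,\omega)=\langle g,e^{2\pi i\omega\,\cdot}\varphi(\cdot-x)\rangle$ (pairing conjugate-linear in the second slot) and $\varphi(t)=2^{1/4}e^{-\pi t^2}$. A stationary, circularly symmetric generalized complex Gaussian process (noise) with PSD $S$ is a linear map $\mathcal{W}_S$ from the Schwartz space $\mathcal{S}(\mathbb{R})$ to $L^2$ complex random variables on a probability space, which is continuous ($\phi_k\to0$ in $\mathcal{S}(\mathbb{R})$ implies $\mathbb{E}|\mathcal{W}_S(\phi_k)|^2\to0$), whose finite-dimensional vectors $(\mathcal{W}_S(\phi_1),\dots,\mathcal{W}_S(\phi_n))$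 are circularly symmetric jointly complex Gaussian, and with $\mathbb{E}[\langle\mathcal{W}_S,\psi_1\rangle\overline{\langle\mathcal{W}_S,\psi_2\rangle}]=\int_{\mathbb{R}}\mathcal{F}\{\psi_2\}\overline{\mathcal{F}\{\psi_1\}}S\,d\omega$, where $\langle\mathcal{W}_S,\psi\rangle=\mathcal{W}_S(\overline\psi)$ and $\mathcal{F}\{g\}(\omega)=\int g(t)e^{-2\pi it\omega}dt$; almost every realization is a tempered distribution. *)

theory Defs
  imports "HOL-Probability.Probability"
begin

section \<open>Schwartz functions and tempered distributions on the line\<close>

definition iter_deriv :: "nat \<Rightarrow> (real \<Rightarrow> complex) \<Rightarrow> real \<Rightarrow> complex" where
  "iter_deriv n f = ((\<lambda>g t. vector_derivative g (at t)) ^^ n) f"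

definition schwartz :: "(real \<Rightarrow> complex) \<Rightarrow> bool" where
  "schwartz f \<longleftrightarrow>
     (\<forall>n t. iter_deriv n f differentiable (at t)) \<and>
     (\<forall>m n. bounded (range (\<lambda>t. t ^ m *\<^sub>R iter_deriv n f t)))"

definition schwartz_null :: "(nat \<Rightarrow> real \<Rightarrow> complex) \<Rightarrow> bool" where
  "schwartz_null \<Phi> \<longleftrightarrow>
     (\<forall>k. schwartz (\<Phi> k)) \<and>
     (\<forall>m n. uniform_limit UNIV (\<lambda>k t. t ^ m *\<^sub>R iter_deriv n (\<Phi> k) t) (\<lambda>t. 0) sequentially)"

text \<open>A functional is given as a total function on \<^typ>\<open>real \<Rightarrow> complex\<close>; only its values at
  Schwartz functions are relevant. Since the Schwartz space is metrizable, sequential continuity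
  is continuity.\<close>

definition tempered_distribution :: "((real \<Rightarrow> complex) \<Rightarrow> complex) \<Rightarrow> bool" where
  "tempered_distribution g \<longleftrightarrow>
     (\<forall>\<phi> \<psi> c d. schwartz \<phi> \<longrightarrow> schwartz \<psi> \<longrightarrow>
        g (\<lambda>t. c * \<phi> t + d * \<psi> t) = c * g \<phi> + d * g \<psi>) \<and>
     (\<forall>\<Phi>. schwartz_null \<Phi> \<longrightarrow> (\<lambda>k. g (\<Phi> k)) \<longlonglongrightarrow> 0)"

text \<open>The pairing is conjugate-linear in the second slot.\<close>

definition pairing :: "((real \<Rightarrow> complex) \<Rightarrow> complex) \<Rightarrow> (real \<Rightarrow> complex) \<Rightarrow> complex" where
  "pairing g \<psi> = g (\<lambda>t. cnj (\<psi> t))"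

definition fourier :: "(real \<Rightarrow> complex) \<Rightarrow> real \<Rightarrow> complex" where
  "fourier g \<omega> = (LINT t|lborel. g t * exp (- 2 * of_real pi * \<i> * of_real t * of_real \<omega>))"


section \<open>Spectrogram with Gaussian window\<close>

definition gauss_window :: "real \<Rightarrow> complex" where
  "gauss_window t = of_real (2 powr (1/4) * exp (- pi * t\<^sup>2))"

definition stft :: "((real \<Rightarrow> complex) \<Rightarrow> complex) \<Rightarrow> real \<Rightarrow> real \<Rightarrow> complex" where
  "stft g x \<omega> =
     pairing g (\<lambda>t. exp (2 * of_real pi * \<i> * of_real \<omega> * of_real t) * gauss_window (t - x))"

definition spectrogram :: "((real \<Rightarrow> complex) \<Rightarrow> complex) \<Rightarrow> real \<Rightarrow> real \<Rightarrow> real" where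
  "spectrogram g x \<omega> = (cmod (stft g x \<omega>))\<^sup>2"


section \<open>Circularly symmetric Gaussian noise\<close>

text \<open>Constants count as (degenerate) Gaussian random variables.\<close>

definition gaussian_rv :: "'a measure \<Rightarrow> ('a \<Rightarrow> real) \<Rightarrow> bool" where
  "gaussian_rv M X \<longleftrightarrow>
     (\<exists>\<mu>. X \<in> borel_measurable M \<and> (AE s in M. X s = \<mu>)) \<or>
     (\<exists>\<mu> \<sigma>. 0 < \<sigma> \<and> distributed M lborel X (\<lambda>x. ennreal (normal_density \<mu> \<sigma> x)))"

text \<open>Joint Gaussianity of a complex vector is joint Gaussianity of its real and imaginary parts
  (every real linear combination is Gaussian); circular symmetry is invariance of the joint
  law under multiplication by a common phase.\<close>

definition circ_sym_gaussian :: "'a measure \<Rightarrow> nat \<Rightarrow> (nat \<Rightarrow> 'a \<Rightarrow> complex) \<Rightarrow> bool" where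
  "circ_sym_gaussian M n Z \<longleftrightarrow>
     (\<forall>i<n. Z i \<in> borel_measurable M) \<and>
     (\<forall>(u :: nat \<Rightarrow> real) (v :: nat \<Rightarrow> real).
        gaussian_rv M (\<lambda>s. \<Sum>i<n. u i * Re (Z i s) + v i * Im (Z i s))) \<and>
     (\<forall>\<theta>. distr M (Pi\<^sub>M {..<n} (\<lambda>_. borel)) (\<lambda>s. \<lambda>i\<in>{..<n}. cis \<theta> * Z i s) =
          distr M (Pi\<^sub>M {..<n} (\<lambda>_. borel)) (\<lambda>s. \<lambda>i\<in>{..<n}. Z i s))"

text \<open>\<open>W \<phi>\<close> is a representative of an \<open>L\<^sup>2\<close> random variable, so linearity is required almost
  surely for each choice of arguments. The last assumption selects representatives for which
  almost every realization \<open>\<lambda>\<phi>. W \<phi> s\<close> is a tempered distribution.\<close>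

locale psd_noise = prob_space M
  for M :: "'a measure" +
  fixes W :: "(real \<Rightarrow> complex) \<Rightarrow> 'a \<Rightarrow> complex"
    and S :: "real \<Rightarrow> real"
  assumes rv: "schwartz \<phi> \<Longrightarrow> W \<phi> \<in> borel_measurable M"
    and square_integrable: "schwartz \<phi> \<Longrightarrow> integrable M (\<lambda>s. (cmod (W \<phi> s))\<^sup>2)"
    and linear: "schwartz \<phi> \<Longrightarrow> schwartz \<psi> \<Longrightarrow>
          AE s in M. W (\<lambda>t. c * \<phi> t + d * \<psi> t) s = c * W \<phi> s + d * W \<psi> s"
    and continuous: "schwartz_null \<Phi> \<Longrightarrow>
          (\<lambda>k. expectation (\<lambda>s. (cmod (W (\<Phi> k) s))\<^sup>2)) \<longlonglongrightarrow> 0"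
    and gaussian: "(\<And>i. i < n \<Longrightarrow> schwartz (\<Psi> i)) \<Longrightarrow> circ_sym_gaussian M n (\<lambda>i. W (\<Psi> i))"
    and covariance: "schwartz \<psi>\<^sub>1 \<Longrightarrow> schwartz \<psi>\<^sub>2 \<Longrightarrow>
          (LINT s|M. pairing (\<lambda>\<phi>. W \<phi> s) \<psi>\<^sub>1 * cnj (pairing (\<lambda>\<phi>. W \<phi> s) \<psi>\<^sub>2)) =
          (LINT \<xi>|lborel. fourier \<psi>\<^sub>2 \<xi> * cnj (fourier \<psi>\<^sub>1 \<xi>) * of_real (S \<xi>))"
    and realizations: "AE s in M. tempered_distribution (\<lambda>\<phi>. W \<phi> s)"


section \<open>First intensity of the spectrogram zeros\<close>

definition zero_count ::
    "((real \<Rightarrow> complex) \<Rightarrow> 'a \<Rightarrow> complex) \<Rightarrow> (real \<times> real) set \<Rightarrow> 'a \<Rightarrow> ennreal" where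
  "zero_count W \<Omega> s =
     emeasure (count_space UNIV) {(\<tau>, \<omega>) \<in> \<Omega>. spectrogram (\<lambda>\<phi>. W \<phi> s) \<tau> \<omega> = 0}"

text \<open>Realizations are only controlled outside a null set of \<open>M\<close>, so the number of zeros is a
  random variable on the completion of \<open>M\<close>.\<close>

definition first_intensity_spec ::
    "'a measure \<Rightarrow> ((real \<Rightarrow> complex) \<Rightarrow> 'a \<Rightarrow> complex) \<Rightarrow> (real \<Rightarrow> real \<Rightarrow> real) \<Rightarrow> bool" where
  "first_intensity_spec M W \<rho> \<longleftrightarrow>
     (\<lambda>(\<tau>, \<omega>). \<rho> \<tau> \<omega>) \<in> borel_measurable borel \<and>
     (\<forall>\<tau> \<omega>. 0 \<le> \<rho> \<tau> \<omega>) \<and>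
     (\<forall>\<Omega> \<in> sets borel.
        zero_count W \<Omega> \<in> borel_measurable (completion M) \<and>
        (\<integral>\<^sup>+ s. zero_count W \<Omega> s \<partial>completion M) =
        (\<integral>\<^sup>+ (\<tau>, \<omega>) \<in> \<Omega>. ennreal (\<rho> \<tau> \<omega>) \<partial>lborel))"

end

(*
  With z = tau - i omega, the short-time Fourier transform at (tau, omega) is a nonvanishing factor
  times F(z) = W(psi_z), where psi_z(t) = exp(2 pi z t - pi t^2).  Since the Taylor expansion of psi_z
  in z converges in the Schwartz space, almost every realization of F is entire, with derivative
  F'(z) = 2 pi W(t psi_z(t)).  By the argument principle the number of zeros of F in a rectangle is
  the contour integral of F'/F over its boundary, divided by 2 pi i.  At a fixed z the pair
  (F(z), F'(z)) is circularly symmetric Gaussian, so F'(z) = h(z) F(z) + Y with Y independent of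
  F(z), whence E[F'/F] = h(z) with h(z) = E[F' conj(F)] / E|F|^2, a real-linear function of z that
  the covariance gives explicitly.  The contour integral of h is 2 pi i (1 - b / (2 pi + b)) times
  the area.  Almost surely no zero lies on a given segment and all zeros are simple, and the passage
  from rectangles to Borel sets is a Dynkin class argument.
*)
theory Submission
  imports Defs "HOL-Complex_Analysis.Complex_Analysis"
begin

section \<open>Gaussian wave packets and the Bargmann transform\<close>

text \<open>Everything quantitative rests on P(|F(z)| <= r) = O(r^2), locally uniformly in z. It
  makes E|F'/F| finite and bounded by a continuous function of z, so Fubini can exchange expectation
  and contour integral. It also drives the grid arguments: about n points on a segment with
  threshold of order 1/n, or about n^2 points in a square with threshold of order 1/n^2, have total
  failure probability tending to 0. Simplicity matters because the zero count ignores multiplicities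
  while the argument principle does not. The area appears because h is not holomorphic. In the code
  h / (2 pi) is \<open>drift\<close> z = x + i \<beta> y with \<beta> = b / (2 pi + b); its d-bar
  derivative is (1 - \<beta>) / 2, and Green's formula gives i (1 - \<beta>) times the area. White
  noise, the limit b -> 0, would give density 1. Linearity of \<open>W\<close> holds almost surely
  only for each fixed choice of arguments, so every pathwise statement goes through the single event
  that the realization is a tempered distribution. The count in a box is seen to be measurable only
  through its almost sure equality with a contour integral, which is where the completion
  enters.\<close>

text \<open>The convention \<open>0 - 1 = 0\<close> makes the derivative rule below hold for \<open>N = 0\<close> as well.\<close>

definition exp_tail :: "nat \<Rightarrow> complex \<Rightarrow> complex" where
  "exp_tail N w = exp w - (\<Sum>j<N. w ^ j /\<^sub>R fact j)"

section \<open>Quantitative tails of the exponential series\<close>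

lemma exp_tail_0 [simp]: "exp_tail 0 w = exp w"
  by (simp add: exp_tail_def)

lemma exp_tail_Suc: "exp_tail (Suc N) w = exp_tail N w - w ^ N /\<^sub>R fact N"
  by (simp add: exp_tail_def)

lemma has_field_derivative_exp_tail:
  "(exp_tail N has_field_derivative exp_tail (N - 1) w) (at w)"
proof (induction N)
  case 0
  then show ?case
    by (auto simp: exp_tail_def[abs_def] intro!: derivative_eq_intros)
next
  case (Suc N)
  have "((\<lambda>w. exp_tail N w - w ^ N /\<^sub>R fact N) has_field_derivative
      exp_tail (N - 1) w - (of_nat N * w ^ (N - 1)) /\<^sub>R fact N) (at w)"
    by (auto intro!: derivative_eq_intros Suc simp: scaleR_conv_of_real)
  moreover have "exp_tail (N - 1) w - (of_nat N * w ^ (N - 1)) /\<^sub>R fact N = exp_tail N w"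
    by (cases N) (auto simp: exp_tail_Suc scaleR_conv_of_real field_simps simp del: of_nat_Suc)
  ultimately show ?case
    by (simp add: exp_tail_Suc[abs_def])
qed

text \<open>For j >= N the factor 2^j is at least 2^N, so doubling the argument of the exponential
  series pays for a gain of 2^-N.\<close>

lemma norm_exp_tail_le: "cmod (exp_tail N w) \<le> exp (2 * cmod w) / 2 ^ N"
proof -
  have s: "(\<lambda>j. w ^ j /\<^sub>R fact j) sums exp w" by (rule exp_converges)
  have s2: "(\<lambda>j. (2 * cmod w) ^ j /\<^sub>R fact j) sums exp (2 * cmod w)" by (rule exp_converges)
  have t: "(\<lambda>j. w ^ (j + N) /\<^sub>R fact (j + N)) sums exp_tail N w"
    unfolding exp_tail_def using s by (rule sums_split_initial_segment)
  have ts2: "summable (\<lambda>j. (2 * cmod w) ^ (j + N) /\<^sub>R fact (j + N))"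
    using sums_summable[OF s2] by (subst summable_iff_shift)
  have le: "norm (w ^ (j + N) /\<^sub>R fact (j + N)) \<le> (1 / 2 ^ N) * ((2 * cmod w) ^ (j + N) /\<^sub>R fact (j + N))" for j
  proof -
    have "cmod w ^ (j + N) / fact (j + N) * 1 \<le> cmod w ^ (j + N) / fact (j + N) * 2 ^ j"
      by (intro mult_left_mono) auto
    then show ?thesis
      by (simp add: norm_power norm_mult norm_divide power_add power_mult_distrib field_simps)
  qed
  have "cmod (exp_tail N w) \<le> (\<Sum>j. (1 / 2 ^ N) * ((2 * cmod w) ^ (j + N) /\<^sub>R fact (j + N)))"
    unfolding sums_unique[OF t] by (intro norm_suminf_le summable_mult ts2 le)
  also have "\<dots> = (1 / 2 ^ N) * (\<Sum>j. (2 * cmod w) ^ (j + N) /\<^sub>R fact (j + N))"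
    by (rule suminf_mult[OF ts2])
  also have "(\<Sum>j. (2 * cmod w) ^ (j + N) /\<^sub>R fact (j + N)) \<le> exp (2 * cmod w)"
    using suminf_split_initial_segment[OF sums_summable[OF s2], of N] sums_unique[OF s2]
    by (simp add: sum_nonneg)
  finally show ?thesis by (simp add: mult_left_mono divide_simps)
qed

text \<open>Growth exp (k |t|) is all that the Gaussian factor has to absorb later; each Horner step
  costs one factor exp |t| >= |t|.\<close>

lemma norm_poly_le_exp:
  fixes p :: "complex poly"
  obtains C k where "C \<ge> 0" "k \<ge> 0" "\<And>t::real. cmod (poly p (of_real t)) \<le> C * exp (k * \<bar>t\<bar>)"
proof -
  have "\<exists>C k. C \<ge> 0 \<and> k \<ge> 0 \<and> (\<forall>t::real. cmod (poly p (of_real t)) \<le> C * exp (k * \<bar>t\<bar>))"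
  proof (induction p)
    case 0
    show ?case by (auto intro!: exI[of _ 0])
  next
    case (pCons a p)
    then obtain C k where C: "C \<ge> 0" "k \<ge> 0" "\<And>t::real. cmod (poly p (of_real t)) \<le> C * exp (k * \<bar>t\<bar>)"
      by blast
    have "cmod (poly (pCons a p) (of_real t)) \<le> (cmod a + C) * exp ((k + 1) * \<bar>t\<bar>)" for t :: real
    proof -
      have "cmod (poly (pCons a p) (of_real t)) \<le> cmod a + \<bar>t\<bar> * cmod (poly p (of_real t))"
        using norm_triangle_ineq[of a "of_real t * poly p (of_real t)"] by (simp add: norm_mult)
      also have "\<dots> \<le> cmod a * exp ((k + 1) * \<bar>t\<bar>) + exp \<bar>t\<bar> * (C * exp (k * \<bar>t\<bar>))"
      proof (intro add_mono mult_mono C)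
        show "cmod a \<le> cmod a * exp ((k + 1) * \<bar>t\<bar>)"
          using C by (simp add: mult_le_cancel_left1)
        show "\<bar>t\<bar> \<le> exp \<bar>t\<bar>" using exp_ge_add_one_self[of "\<bar>t\<bar>"] by linarith
      qed auto
      also have "\<dots> = (cmod a + C) * exp ((k + 1) * \<bar>t\<bar>)"
        by (simp add: algebra_simps exp_add)
      finally show ?thesis .
    qed
    then show ?case using C by (intro exI[of _ "cmod a + C"] exI[of _ "k + 1"]) auto
  qed
  then show ?thesis using that by blast
qed

text \<open>The Taylor remainders in \<open>z\<close> of the wave packets, closed up under differentiation in \<open>t\<close>; all their
  Schwartz seminorms decay like \<open>2\<^sup>-\<^sup>N\<close>.\<close>

definition tail_atom :: "complex \<Rightarrow> complex poly \<Rightarrow> nat \<Rightarrow> nat \<Rightarrow> real \<Rightarrow> complex" where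
  "tail_atom z p i N t =
     exp (- of_real pi * (of_real t)\<^sup>2) * poly p (of_real t) * exp_tail (N - i) (2 * of_real pi * z * of_real t)"

text \<open>The members are whole sequences in N, so that one constant can serve all N. Sums are
  included because the product rule turns one atom into two.\<close>

inductive_set tail_families :: "complex \<Rightarrow> (nat \<Rightarrow> real \<Rightarrow> complex) set" for z where
  atom: "tail_atom z p i \<in> tail_families z"
| add: "f \<in> tail_families z \<Longrightarrow> g \<in> tail_families z \<Longrightarrow> (\<lambda>N t. f N t + g N t) \<in> tail_families z"

lemma tail_families_mult_power:
  "f \<in> tail_families z \<Longrightarrow> (\<lambda>N t. t ^ m *\<^sub>R f N t) \<in> tail_families z"
proof (induction rule: tail_families.induct)
  case (atom p i)
  have "(\<lambda>N t. t ^ m *\<^sub>R tail_atom z p i N t) = tail_atom z (monom 1 m * p) i"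
    by (auto simp: tail_atom_def fun_eq_iff poly_monom scaleR_conv_of_real)
  then show ?case by (simp add: tail_families.atom)
next
  case (add f g)
  then show ?case by (simp add: scaleR_add_right tail_families.add)
qed

lemma tail_families_deriv:
  "f \<in> tail_families z \<Longrightarrow>
    \<exists>g\<in>tail_families z. \<forall>N t. (f N has_vector_derivative g N t) (at t)"
proof (induction rule: tail_families.induct)
  case (atom p i)
  \<comment> \<open>The first atom differentiates the polynomial and the Gaussian. The second
    differentiates the exponential tail, which lowers its order by one and brings out 2 pi
    z.\<close>
  define g where "g = (\<lambda>N t. tail_atom z (pderiv p - smult (2 * of_real pi) (monom 1 1 * p)) i N t
     + tail_atom z (smult (2 * of_real pi * z) p) (Suc i) N t)"
  have "(tail_atom z p i N has_vector_derivative g N t) (at t)" for N t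
  proof -
    have "((\<lambda>w. exp (- of_real pi * w\<^sup>2) * poly p w * exp_tail (N - i) (2 * of_real pi * z * w))
       has_field_derivative g N t) (at (of_real t))"
      unfolding g_def tail_atom_def
      by (rule derivative_eq_intros DERIV_chain2[OF has_field_derivative_exp_tail] poly_DERIV refl)+
         (simp add: poly_monom power2_eq_square algebra_simps)
    then show ?thesis
      unfolding tail_atom_def[abs_def] by (rule has_vector_derivative_real_field)
  qed
  moreover have "g \<in> tail_families z"
    unfolding g_def by (rule tail_families.add; rule tail_families.atom)
  ultimately show ?case by blast
next
  case (add f g)
  then obtain f' g' where "f' \<in> tail_families z" "\<forall>N t. (f N has_vector_derivative f' N t) (at t)"
    "g' \<in> tail_families z" "\<forall>N t. (g N has_vector_derivative g' N t) (at t)" by blast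
  then show ?case
    by (intro bexI[of _ "\<lambda>N t. f' N t + g' N t"] tail_families.add)
       (auto intro!: has_vector_derivative_add)
qed

lemma tail_families_iter_deriv:
  assumes "f \<in> tail_families z"
  shows "(\<lambda>N. iter_deriv n (f N)) \<in> tail_families z"
proof (induction n)
  case 0
  then show ?case using assms by (simp add: iter_deriv_def)
next
  case (Suc n)
  obtain g where g: "g \<in> tail_families z"
     "\<And>N t. (iter_deriv n (f N) has_vector_derivative g N t) (at t)"
    using tail_families_deriv[OF Suc] by blast
  have "(\<lambda>N. iter_deriv (Suc n) (f N)) = g"
    using g(2)[THEN vector_derivative_at] by (auto simp: iter_deriv_def fun_eq_iff)
  then show ?case using g by simp
qed

lemma tail_families_bound:
  "f \<in> tail_families z \<Longrightarrow> \<exists>C\<ge>0. \<forall>N t. cmod (f N t) \<le> C / 2 ^ N"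
proof (induction rule: tail_families.induct)
  case (atom p i)
  obtain C k where C: "C \<ge> 0" "k \<ge> 0" "\<And>t::real. cmod (poly p (of_real t)) \<le> C * exp (k * \<bar>t\<bar>)"
    using norm_poly_le_exp[of p] by blast
  \<comment> \<open>The exponential growth rate left against the Gaussian: k from the polynomial, 4
    pi |z| from the doubled argument in \<open>norm_exp_tail_le\<close>.\<close>
  define A where "A = k + 4 * pi * cmod z"
  have "cmod (tail_atom z p i N t) \<le> C * exp (A\<^sup>2 / (4 * pi)) * 2 ^ i / 2 ^ N" for N t
  proof -
    have e: "exp (- of_real pi * (of_real t)\<^sup>2 :: complex) = of_real (exp (- pi * t\<^sup>2))"
      by (simp add: exp_of_real[symmetric])
    have "cmod (tail_atom z p i N t) = exp (- pi * t\<^sup>2) * cmod (poly p (of_real t))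
        * cmod (exp_tail (N - i) (2 * of_real pi * z * of_real t))"
      unfolding tail_atom_def norm_mult e norm_of_real by simp
    also have "\<dots> \<le> exp (- pi * t\<^sup>2) * (C * exp (k * \<bar>t\<bar>))
        * (exp (2 * cmod (2 * of_real pi * z * of_real t)) / 2 ^ (N - i))"
      by (intro mult_mono norm_exp_tail_le C order.refl mult_nonneg_nonneg) auto
    also have "\<dots> = C * exp (- pi * t\<^sup>2 + A * \<bar>t\<bar>) * (1 / 2 ^ (N - i))"
      by (simp add: norm_mult A_def exp_add exp_diff algebra_simps exp_minus divide_simps)
    also have "\<dots> \<le> C * exp (A\<^sup>2 / (4 * pi)) * (2 ^ i / 2 ^ N)"
    proof (intro mult_mono mult_left_mono C)
      \<comment> \<open>Completing the square: - pi t^2 + A |t| is largest at |t| = A / (2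
        pi).\<close>
      have "0 \<le> (2 * pi * \<bar>t\<bar> - A)\<^sup>2" by simp
      then have "4 * pi * (A * \<bar>t\<bar>) \<le> A\<^sup>2 + 4 * pi * (pi * t\<^sup>2)"
        by (simp add: power2_diff power_mult_distrib algebra_simps power2_eq_square)
      then have "- pi * t\<^sup>2 + A * \<bar>t\<bar> \<le> A\<^sup>2 / (4 * pi)"
        by (simp add: field_simps)
      then show "exp (- pi * t\<^sup>2 + A * \<bar>t\<bar>) \<le> exp (A\<^sup>2 / (4 * pi))" by simp
      \<comment> \<open>This form also covers i > N, where the truncated difference N - i is
        0.\<close>
      have "(2::real) ^ N \<le> 2 ^ (i + (N - i))" by (intro power_increasing) auto
      then show "1 / 2 ^ (N - i) \<le> (2 ^ i / 2 ^ N :: real)"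
        by (simp add: field_simps power_add)
    qed (use C in auto)
    finally show ?thesis by simp
  qed
  then show ?case using C
    by (intro exI[of _ "C * exp (A\<^sup>2 / (4 * pi)) * 2 ^ i"]) auto
next
  case (add f g)
  then obtain C D where "C \<ge> 0" "\<forall>N t. cmod (f N t) \<le> C / 2 ^ N" "D \<ge> 0" "\<forall>N t. cmod (g N t) \<le> D / 2 ^ N"
    by blast
  then show ?case
    by (intro exI[of _ "C + D"]) (auto simp: add_divide_distrib intro!: norm_triangle_mono)
qed

lemma tail_families_schwartz:
  assumes f: "f \<in> tail_families z"
  shows "schwartz (f N)"
  unfolding schwartz_def
proof (intro conjI allI)
  fix n t
  show "iter_deriv n (f N) differentiable at t"
    using tail_families_deriv[OF tail_families_iter_deriv[OF f, of n]]
    by (auto intro: differentiableI_vector)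
next
  fix m n
  obtain C where "\<forall>N t. cmod (t ^ m *\<^sub>R iter_deriv n (f N) t) \<le> C / 2 ^ N"
    using tail_families_bound[OF tail_families_mult_power[OF tail_families_iter_deriv[OF f]]] by blast
  then show "bounded (range (\<lambda>t. t ^ m *\<^sub>R iter_deriv n (f N) t))"
    by (intro boundedI[of _ "C / 2 ^ N"]) auto
qed

lemma tail_families_null:
  assumes f: "f \<in> tail_families z"
  shows "schwartz_null f"
  unfolding schwartz_null_def
proof (intro conjI allI)
  show "schwartz (f k)" for k using f by (rule tail_families_schwartz)
  fix m n
  obtain C where C: "\<And>N t. cmod (t ^ m *\<^sub>R iter_deriv n (f N) t) \<le> C / 2 ^ N"
    using tail_families_bound[OF tail_families_mult_power[OF tail_families_iter_deriv[OF f]]] by blast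
  have "(\<lambda>N. C / 2 ^ N) \<longlonglongrightarrow> 0"
    using tendsto_mult[OF tendsto_const[of C] LIMSEQ_power_zero[of "1/2::real"]]
    by (simp add: power_divide)
  then have *: "\<forall>\<^sub>F N in sequentially. C / 2 ^ N < e" if "e > 0" for e
    using that by (rule order_tendstoD)
  show "uniform_limit UNIV (\<lambda>k t. t ^ m *\<^sub>R iter_deriv n (f k) t) (\<lambda>t. 0) sequentially"
  proof (rule uniform_limitI)
    fix e :: real assume "e > 0"
    from *[OF this] show "\<forall>\<^sub>F N in sequentially. \<forall>t\<in>UNIV. dist (t ^ m *\<^sub>R iter_deriv n (f N) t) 0 < e"
      by eventually_elim (use C in \<open>auto simp: dist_norm intro: le_less_trans\<close>)
  qed
qed

section \<open>Wave packets, and realizations as entire functions\<close>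

definition coherent :: "nat \<Rightarrow> complex \<Rightarrow> real \<Rightarrow> complex" where
  "coherent k z t = of_real t ^ k * exp (2 * of_real pi * z * of_real t - of_real pi * (of_real t)\<^sup>2)"

text \<open>A Taylor remainder of order 0 is the full exponential, so the wave packets inherit the
  Schwartz estimates of the tails.\<close>

lemma coherent_eq_tail_atom: "coherent k z = tail_atom z (monom 1 k) 0 0"
  by (auto simp: coherent_def tail_atom_def fun_eq_iff poly_monom exp_diff exp_minus field_simps)

lemma schwartz_coherent: "schwartz (coherent k z)"
  unfolding coherent_eq_tail_atom by (rule tail_families_schwartz[OF tail_families.atom])

text \<open>Consecutive tails differ by one Taylor term, a multiple of some
  \<open>coherent (N + k) 0\<close>. Linearity peels these terms off one at a time; continuity sends
  the remaining tail to 0.\<close>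

lemma tempered_distribution_coherent_sums:
  assumes g: "tempered_distribution g"
  shows "(\<lambda>j. (2 * of_real pi * z) ^ j /\<^sub>R fact j * g (coherent (j + k) 0)) sums g (coherent k z)"
proof -
  have lin: "g (\<lambda>t. c * \<phi> t + d * \<psi> t) = c * g \<phi> + d * g \<psi>" if "schwartz \<phi>" "schwartz \<psi>" for \<phi> \<psi> c d
    using g that unfolding tempered_distribution_def by blast
  let ?f = "tail_atom z (monom 1 k) 0"
  have fam: "?f \<in> tail_families z" by (rule tail_families.atom)
  have eq: "g (?f N) = g (coherent k z) - (\<Sum>j<N. (2 * of_real pi * z) ^ j /\<^sub>R fact j * g (coherent (j + k) 0))" for N
  proof (induction N)
    case 0
    then show ?case by (simp add: coherent_eq_tail_atom)
  next
    case (Suc N)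
    have "?f (Suc N) = (\<lambda>t. 1 * ?f N t + (- ((2 * of_real pi * z) ^ N /\<^sub>R fact N)) * coherent (N + k) 0 t)"
      by (auto simp: fun_eq_iff tail_atom_def exp_tail_Suc coherent_def poly_monom scaleR_conv_of_real
          power_add power_mult_distrib algebra_simps)
    then have "g (?f (Suc N)) = 1 * g (?f N) + (- ((2 * of_real pi * z) ^ N /\<^sub>R fact N)) * g (coherent (N + k) 0)"
      using lin[OF tail_families_schwartz[OF fam, of N] schwartz_coherent] by metis
    then show ?case using Suc by simp
  qed
  have "(\<lambda>N. g (?f N)) \<longlonglongrightarrow> 0"
    using g tail_families_null[OF fam] unfolding tempered_distribution_def by blast
  then have "(\<lambda>N. g (coherent k z) - g (?f N)) \<longlonglongrightarrow> g (coherent k z) - 0"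
    by (intro tendsto_diff tendsto_const)
  then show ?thesis unfolding sums_def eq by simp
qed

text \<open>The power series converges everywhere, so it may be differentiated termwise; up to the
  factor 2 pi this shifts the coefficients, turning the series for k into the one for k + 1.\<close>

lemma tempered_distribution_coherent_deriv:
  assumes g: "tempered_distribution g"
  shows "((\<lambda>z. g (coherent k z)) has_field_derivative 2 * of_real pi * g (coherent (Suc k) z)) (at z)"
proof -
  define c where "c = (\<lambda>j. (2 * of_real pi) ^ j /\<^sub>R fact j * g (coherent (j + k) 0))"
  have s: "(\<lambda>j. c j * z ^ j) sums g (coherent k z)" for z
    using tempered_distribution_coherent_sums[OF g, of z k]
    by (simp add: c_def power_mult_distrib mult_ac scaleR_conv_of_real)
  have "(\<lambda>j. diffs c j * z ^ j) sums (2 * of_real pi * g (coherent (Suc k) z))"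
    using sums_mult[OF tempered_distribution_coherent_sums[OF g, of z "Suc k"], of "2 * of_real pi"]
    by (simp add: c_def power_mult_distrib mult_ac scaleR_conv_of_real diffs_def divide_simps
        del: of_nat_Suc)
  then have d: "(\<Sum>j. diffs c j * z ^ j) = 2 * of_real pi * g (coherent (Suc k) z)"
    by (rule sums_unique[symmetric])
  have "((\<lambda>z. \<Sum>j. c j * z ^ j) has_field_derivative (\<Sum>j. diffs c j * z ^ j)) (at z)"
    by (rule termdiffs_strong_converges_everywhere) (use s sums_summable in blast)
  then show ?thesis unfolding d using sums_unique[OF s] by simp
qed

text \<open>Conjugation in the second slot of the pairing turns \<omega> into - \<omega>; expanding
  the square in the shifted window leaves exp (- pi x^2), which does not depend on t.\<close>

lemma stft_eq_coherent:
  assumes g: "tempered_distribution g"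
  shows "stft g x \<omega> = of_real (2 powr (1/4) * exp (- pi * x\<^sup>2)) * g (coherent 0 (Complex x (- \<omega>)))"
proof -
  let ?c = "complex_of_real (2 powr (1/4) * exp (- pi * x\<^sup>2))"
  have "cnj (exp (2 * of_real pi * \<i> * of_real \<omega> * of_real t) * gauss_window (t - x)) =
     ?c * coherent 0 (Complex x (- \<omega>)) t" for t
  proof -
    have "cnj (exp (2 * of_real pi * \<i> * of_real \<omega> * of_real t) * gauss_window (t - x)) =
       of_real (2 powr (1/4)) * exp (- (2 * of_real pi * \<i> * of_real \<omega> * of_real t) - of_real (pi * (t - x)\<^sup>2))"
      by (simp add: gauss_window_def exp_cnj exp_of_real[symmetric] exp_diff exp_minus field_simps del: exp_of_real)
    also have "- (2 * of_real pi * \<i> * of_real \<omega> * of_real t) - of_real (pi * (t - x)\<^sup>2) =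
       of_real (- pi * x\<^sup>2) + (2 * of_real pi * Complex x (- \<omega>) * of_real t - of_real pi * (of_real t)\<^sup>2)"
      by (simp add: Complex_eq power2_eq_square algebra_simps)
    finally show ?thesis
      unfolding coherent_def exp_add exp_of_real by (simp only: of_real_mult power_0 mult_1 mult.assoc)
  qed
  \<comment> \<open>Linearity is stated for combinations of two functions, so a zero multiple is
    added.\<close>
  then have "stft g x \<omega> = g (\<lambda>t. ?c * coherent 0 (Complex x (- \<omega>)) t + 0 * coherent 0 (Complex x (- \<omega>)) t)"
    by (simp add: stft_def pairing_def)
  also have "\<dots> = ?c * g (coherent 0 (Complex x (- \<omega>))) + 0 * g (coherent 0 (Complex x (- \<omega>)))"
    using g schwartz_coherent unfolding tempered_distribution_def by blast
  finally show ?thesis by simp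
qed

lemma spectrogram_eq_0_iff:
  assumes g: "tempered_distribution g"
  shows "spectrogram g x \<omega> = 0 \<longleftrightarrow> g (coherent 0 (Complex x (- \<omega>))) = 0"
  by (simp add: spectrogram_def stft_eq_coherent[OF g])

section \<open>Gaussian integrals\<close>

lemma norm_exp_i_minus_1_le: "cmod (exp (\<i> * of_real y) - 1) \<le> \<bar>y\<bar>"
  using iexp_approx1[of y 0] by simp

text \<open>Dominated convergence is applied along sequences, so difference quotients are needed in
  sequential form.\<close>

lemma has_vector_derivative_imp_LIMSEQ:
  fixes F :: "real \<Rightarrow> complex"
  assumes F: "(F has_vector_derivative F') (at 0)" and t: "t \<longlonglongrightarrow> 0" "\<And>n. t n > 0"
  shows "(\<lambda>n. (F (t n) - F 0) / of_real (t n)) \<longlonglongrightarrow> F'"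
proof -
  have "((\<lambda>y. (1 / norm (y - 0)) *\<^sub>R (F y - (F 0 + (y - 0) *\<^sub>R F'))) \<longlongrightarrow> 0) (at 0)"
    using F unfolding has_vector_derivative_def has_derivative_within by blast
  moreover have "filterlim t (at 0) sequentially"
    using t by (auto simp: filterlim_at intro!: always_eventually less_imp_neq[symmetric])
  ultimately have "(\<lambda>n. (1 / norm (t n - 0)) *\<^sub>R (F (t n) - (F 0 + (t n - 0) *\<^sub>R F'))) \<longlonglongrightarrow> 0"
    by (rule filterlim_compose)
  moreover have "(1 / norm (t n - 0)) *\<^sub>R (F (t n) - (F 0 + (t n - 0) *\<^sub>R F')) =
     (F (t n) - F 0) / of_real (t n) - F'" for n
    using t(2)[of n] by (simp add: scaleR_conv_of_real field_simps)
  ultimately show ?thesis by (simp add: LIM_zero_iff)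
qed

text \<open>Reads a moment off a Fourier transform: differentiation under the integral sign,
  dominated through |exp (iy) - 1| <= |y|.\<close>

lemma integral_iexp_derivative:
  fixes Z :: "'a \<Rightarrow> complex" and X :: "'a \<Rightarrow> real" and F :: "real \<Rightarrow> complex"
  assumes Z: "integrable M Z" and X: "X \<in> borel_measurable M"
    and XZ: "integrable M (\<lambda>s. of_real (X s) * Z s)"
    and F: "\<And>t. (LINT s|M. exp (\<i> * of_real (t * X s)) * Z s) = F t"
    and F': "(F has_vector_derivative F') (at 0)"
  shows "(LINT s|M. \<i> * (of_real (X s) * Z s)) = F'"
proof -
  define t where "t n = 1 / real (Suc n)" for n
  define q where "q n s = (exp (\<i> * of_real (t n * X s)) - 1) / of_real (t n) * Z s" for n s
  note [measurable] = X borel_measurable_integrable[OF Z]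
  have t0: "t \<longlonglongrightarrow> 0" unfolding t_def using LIMSEQ_inverse_real_of_nat by (simp add: inverse_eq_divide)
  have tpos: "t n > 0" for n by (simp add: t_def)
  have int: "integrable M (\<lambda>s. exp (\<i> * of_real (u * X s)) * Z s)" for u
    by (rule Bochner_Integration.integrable_bound[OF Z]) (auto simp: norm_mult)
  have qF: "(LINT s|M. q n s) = (F (t n) - F 0) / of_real (t n)" for n
  proof -
    have "q n s = (exp (\<i> * of_real (t n * X s)) * Z s - exp (\<i> * of_real (0 * X s)) * Z s) / of_real (t n)" for s
      by (simp add: q_def field_simps)
    then show ?thesis
      using int[of "t n"] int[of 0] by (simp add: F[symmetric])
  qed
  have lim1: "(\<lambda>n. LINT s|M. q n s) \<longlonglongrightarrow> (LINT s|M. \<i> * (of_real (X s) * Z s))"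
  proof (rule integral_dominated_convergence[where w = "\<lambda>s. cmod (of_real (X s) * Z s)"])
    show "integrable M (\<lambda>s. cmod (of_real (X s) * Z s))" using XZ by (rule integrable_norm)
    show "AE s in M. (\<lambda>n. q n s) \<longlonglongrightarrow> \<i> * (of_real (X s) * Z s)"
    proof (rule AE_I2)
      fix s
      have "((\<lambda>u. iexp (u * X s)) has_vector_derivative \<i> * of_real (X s)) (at 0)"
      proof -
        have "((\<lambda>u. u * X s) has_vector_derivative X s) (at 0)"
          by (auto intro!: derivative_eq_intros simp: has_real_derivative_iff_has_vector_derivative[symmetric])
        from vector_diff_chain_at[OF this has_vector_derivative_iexp] show ?thesis
          by (simp add: o_def scaleR_conv_of_real mult.commute)
      qed
      from tendsto_mult_right[OF has_vector_derivative_imp_LIMSEQ[OF this t0 tpos], of "Z s"]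
      show "(\<lambda>n. q n s) \<longlonglongrightarrow> \<i> * (of_real (X s) * Z s)"
        by (simp add: q_def mult.assoc)
    qed
    show "AE s in M. cmod (q n s) \<le> cmod (of_real (X s) * Z s)" for n
    proof (rule AE_I2)
      fix s
      have "cmod (exp (\<i> * of_real (t n * X s)) - 1) \<le> t n * \<bar>X s\<bar>"
        using norm_exp_i_minus_1_le[of "t n * X s"] tpos[of n] by (simp add: abs_mult)
      then have "cmod (exp (\<i> * of_real (t n * X s)) - 1) / t n \<le> \<bar>X s\<bar>"
        using tpos[of n] by (simp add: divide_le_eq mult.commute)
      then show "cmod (q n s) \<le> cmod (of_real (X s) * Z s)"
        unfolding q_def norm_mult norm_divide using tpos[of n] by (intro mult_right_mono) auto
    qed
  qed (auto simp: q_def)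
  have lim2: "(\<lambda>n. (F (t n) - F 0) / of_real (t n)) \<longlonglongrightarrow> F'"
    using F' t0 tpos by (rule has_vector_derivative_imp_LIMSEQ)
  show ?thesis using lim1 lim2 unfolding qF by (rule LIMSEQ_unique)
qed

lemma has_bochner_integral_normal_iexp:
  assumes "\<sigma> > 0"
  shows "has_bochner_integral lborel (\<lambda>x. of_real (normal_density \<mu> \<sigma> x) * iexp (u * x))
     (exp (\<i> * of_real (u * \<mu>) - of_real (\<sigma>\<^sup>2 * u\<^sup>2 / 2)))"
proof -
  have std: "has_bochner_integral lborel (\<lambda>x. of_real (normal_density 0 1 x) * iexp (v * x)) (of_real (exp (- (v\<^sup>2) / 2)))"
    for v
  proof -
    have int: "integrable lborel (\<lambda>x. of_real (normal_density 0 1 x) * iexp (v * x))"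
      by (rule Bochner_Integration.integrable_bound[OF integrable_normal_density[of 1 0]])
         (auto simp: norm_mult)
    have "(LINT x|lborel. of_real (normal_density 0 1 x) * iexp (v * x)) = char std_normal_distribution v"
      unfolding char_def by (subst integral_density) (auto simp: scaleR_conv_of_real)
    then show ?thesis
      using has_bochner_integral_integrable[OF int] by (simp add: char_std_normal_distribution)
  qed
  have eq: "of_real (normal_density \<mu> \<sigma> (\<mu> + \<sigma> * x)) * iexp (u * (\<mu> + \<sigma> * x)) =
     (of_real (normal_density 0 1 x) * iexp (u * \<sigma> * x)) * (iexp (u * \<mu>) / of_real \<sigma>)" for x
    using assms by (simp add: normal_density_def exp_add[symmetric] real_sqrt_mult algebra_simps power_mult_distrib)
  have "exp (\<i> * of_real (u * \<mu>) - of_real (\<sigma>\<^sup>2 * u\<^sup>2 / 2)) =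
      iexp (u * \<mu>) * of_real (exp (- ((u * \<sigma>)\<^sup>2) / 2))"
    unfolding exp_of_real[symmetric] exp_add[symmetric] by (simp add: power_mult_distrib mult.commute)
  then have eq2: "exp (\<i> * of_real (u * \<mu>) - of_real (\<sigma>\<^sup>2 * u\<^sup>2 / 2)) /\<^sub>R \<bar>\<sigma>\<bar> =
      of_real (exp (- ((u * \<sigma>)\<^sup>2) / 2)) * (iexp (u * \<mu>) / of_real \<sigma>)"
    using assms by (simp add: scaleR_conv_of_real field_simps)
  have "has_bochner_integral lborel (\<lambda>x. of_real (normal_density \<mu> \<sigma> (\<mu> + \<sigma> * x)) * iexp (u * (\<mu> + \<sigma> * x)))
      (exp (\<i> * of_real (u * \<mu>) - of_real (\<sigma>\<^sup>2 * u\<^sup>2 / 2)) /\<^sub>R \<bar>\<sigma>\<bar>)"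
    unfolding eq eq2 by (intro has_bochner_integral_mult_left std)
  moreover have "\<sigma> \<noteq> 0" using assms by simp
  ultimately show ?thesis
    by (subst lborel_has_bochner_integral_real_affine_iff[where t = \<mu> and c = \<sigma>]) assumption+
qed

text \<open>With standard deviation 1 / sqrt (2 pi) the normal density is exactly exp (- pi (t -
  p)^2). The real part of c becomes its mean and the imaginary part the frequency of a
  characteristic function.\<close>

lemma has_bochner_integral_gauss:
  fixes c :: complex
  shows "has_bochner_integral lborel (\<lambda>t::real. exp (2 * of_real pi * c * of_real t - of_real pi * (of_real t)\<^sup>2))
     (exp (of_real pi * c\<^sup>2))"
proof -
  obtain p q where c: "c = Complex p q" by (cases c)
  have nd: "normal_density p (1 / sqrt (2 * pi)) t = exp (- pi * (t - p)\<^sup>2)" for t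
    by (simp add: normal_density_def power_divide)
  have "exp (of_real (pi * p\<^sup>2)) * (of_real (normal_density p (1 / sqrt (2 * pi)) t) * iexp (2 * pi * q * t))
     = exp (2 * of_real pi * c * of_real t - of_real pi * (of_real t)\<^sup>2)" for t
    unfolding nd exp_of_real[symmetric] exp_add[symmetric]
    by (rule arg_cong[of _ _ exp]) (simp add: c Complex_eq power2_eq_square algebra_simps)
  moreover have "exp (of_real (pi * p\<^sup>2)) * exp (\<i> * of_real (2 * pi * q * p) - of_real ((1 / sqrt (2 * pi))\<^sup>2 * (2 * pi * q)\<^sup>2 / 2))
     = exp (of_real pi * c\<^sup>2)"
    unfolding exp_add[symmetric]
    by (rule arg_cong[of _ _ exp])
       (simp add: c Complex_eq power2_eq_square power_divide algebra_simps divide_simps)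
  ultimately show ?thesis
    using has_bochner_integral_mult_right[OF has_bochner_integral_normal_iexp[of "1 / sqrt (2 * pi)" p "2 * pi * q"],
      of "exp (of_real (pi * p\<^sup>2))"] by simp
qed

lemma integrable_gauss_mult:
  fixes c :: complex
  shows "integrable lborel (\<lambda>t::real. of_real t * exp (2 * of_real pi * c * of_real t - of_real pi * (of_real t)\<^sup>2))"
proof -
  let ?p = "Re c"
  have nd: "normal_density ?p (1 / sqrt (2 * pi)) t = exp (- pi * (t - ?p)\<^sup>2)" for t
    by (simp add: normal_density_def power_divide)
  have "cmod (of_real t * exp (2 * of_real pi * c * of_real t - of_real pi * (of_real t)\<^sup>2))
      = \<bar>exp (pi * ?p\<^sup>2) * (normal_density ?p (1 / sqrt (2 * pi)) t * t)\<bar>" for t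
    unfolding nd by (simp add: norm_mult abs_mult norm_exp_eq_Re exp_add[symmetric])
      (simp add: power2_eq_square algebra_simps)
  then show ?thesis
    by (intro Bochner_Integration.integrable_bound[OF
          integrable_mult_right[OF integrable_normal_moment_nz_1[of "1 / sqrt (2 * pi)" ?p], of "exp (pi * ?p\<^sup>2)"]])
       auto
qed

lemma integral_gauss_mult:
  fixes c :: complex
  shows "(LINT t|lborel. of_real t * exp (2 * of_real pi * c * of_real t - of_real pi * (of_real t)\<^sup>2))
     = c * exp (of_real pi * c\<^sup>2)"
proof -
  let ?Z = "\<lambda>t::real. exp (2 * of_real pi * c * of_real t - of_real pi * (of_real t)\<^sup>2)"
  \<comment> \<open>Multiplying the integrand by exp (ist) moves c to c + is / (2 pi), so the moment
    is the derivative of the previous integral in the imaginary direction.\<close>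
  define d where "d s = c + \<i> * of_real s / (2 * of_real pi)" for s
  have "(LINT t|lborel. \<i> * (of_real t * ?Z t)) = \<i> * c * exp (of_real pi * c\<^sup>2)"
  proof (rule integral_iexp_derivative)
    show "integrable lborel ?Z"
      using has_bochner_integral_gauss by (rule integrable.intros)
    show "integrable lborel (\<lambda>t. of_real t * ?Z t)" by (rule integrable_gauss_mult)
    show "(LINT t|lborel. iexp (s * t) * ?Z t) = exp (of_real pi * (d s)\<^sup>2)" for s
      using has_bochner_integral_integral_eq[OF has_bochner_integral_gauss[of "d s"]]
      by (simp add: exp_add[symmetric] d_def algebra_simps)
    have "((\<lambda>w. exp (of_real pi * (c + \<i> * w / (2 * of_real pi))\<^sup>2)) has_field_derivative
       \<i> * c * exp (of_real pi * c\<^sup>2)) (at (of_real 0))"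
      by (auto intro!: derivative_eq_intros)
    then show "((\<lambda>s. exp (of_real pi * (d s)\<^sup>2)) has_vector_derivative \<i> * c * exp (of_real pi * c\<^sup>2)) (at 0)"
      unfolding d_def by (rule has_vector_derivative_real_field)
  qed simp
  then show ?thesis by (simp add: mult.assoc)
qed

lemma fourier_coherent_0: "fourier (coherent 0 z) \<xi> = exp (of_real pi * (z - \<i> * of_real \<xi>)\<^sup>2)"
  using has_bochner_integral_integral_eq[OF has_bochner_integral_gauss[of "z - \<i> * of_real \<xi>"]]
  by (simp add: fourier_def coherent_def exp_add[symmetric] algebra_simps)

lemma fourier_coherent_1:
  "fourier (coherent 1 z) \<xi> = (z - \<i> * of_real \<xi>) * exp (of_real pi * (z - \<i> * of_real \<xi>)\<^sup>2)"
  unfolding integral_gauss_mult[symmetric]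
  by (simp add: fourier_def coherent_def exp_add[symmetric] mult.assoc)
     (simp add: algebra_simps)

section \<open>The ratio of jointly Gaussian variables\<close>

text \<open>exp (- a X^2) is the characteristic function of a centred normal law of variance 2a,
  evaluated at X. Fubini thus trades the damping for an average over phases, which is accessible
  from characteristic functions.\<close>

lemma (in prob_space) integral_gauss_damping:
  fixes G :: "'a \<Rightarrow> complex" and X :: "'a \<Rightarrow> real"
  assumes G: "integrable M G" and X[measurable]: "X \<in> borel_measurable M" and a: "a > 0"
  shows "(LINT s|M. G s * of_real (exp (- a * (X s)\<^sup>2))) =
    (LINT k|lborel. of_real (normal_density 0 (sqrt (2 * a)) k) * (LINT s|M. G s * iexp (k * X s)))"
proof -
  interpret pair_sigma_finite lborel M ..
  note [measurable] = borel_measurable_integrable[OF G]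
  define f where "f k s = of_real (normal_density 0 (sqrt (2 * a)) k) * (G s * iexp (k * X s))" for k s
  have nf: "norm (f k s) = normal_density 0 (sqrt (2 * a)) k * norm (G s)" for k s
    by (simp add: f_def norm_mult)
  have Gk: "integrable M (\<lambda>s. G s * iexp (k * X s))" for k
    by (rule Bochner_Integration.integrable_bound[OF G]) (auto simp: norm_mult)
  have int: "integrable (lborel \<Otimes>\<^sub>M M) (case_prod f)"
  proof (rule Fubini_integrable)
    show "case_prod f \<in> borel_measurable (lborel \<Otimes>\<^sub>M M)" unfolding f_def by measurable
    show "integrable lborel (\<lambda>k. LINT s|M. norm (case_prod f (k, s)))"
      using a by (simp add: nf)
    show "AE k in lborel. integrable M (\<lambda>s. case_prod f (k, s))"
      using Gk by (auto simp: f_def)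
  qed
  have "(LINT k|lborel. f k s) = G s * of_real (exp (- a * (X s)\<^sup>2))" for s
  proof -
    have "(LINT k|lborel. f k s) = G s * (LINT k|lborel. of_real (normal_density 0 (sqrt (2 * a)) k) * iexp (X s * k))"
      unfolding f_def by (subst integral_mult_right_zero[symmetric]) (simp add: mult_ac)
    also have "(LINT k|lborel. of_real (normal_density 0 (sqrt (2 * a)) k) * iexp (X s * k)) = of_real (exp (- a * (X s)\<^sup>2))"
      using has_bochner_integral_integral_eq[OF has_bochner_integral_normal_iexp[of "sqrt (2 * a)" 0 "X s"]] a
      by (simp add: exp_of_real[symmetric])
    finally show ?thesis .
  qed
  then show ?thesis
    using Fubini_integral[OF int] by (simp add: f_def)
qed

text \<open>The product is again a multiple of a centred normal density, with variance 2a / (1 + a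
  v).\<close>

lemma integral_normal_exp_square:
  assumes a: "a > 0" and v: "v \<ge> 0"
  shows "(LINT k|lborel. normal_density 0 (sqrt (2 * a)) k * exp (- (k\<^sup>2 * v / 4))) = 1 / sqrt (1 + a * v)"
proof -
  have pos: "1 + a * v > 0" using a v by (simp add: add_pos_nonneg)
  have "normal_density 0 (sqrt (2 * a)) k * exp (- (k\<^sup>2 * v / 4)) =
     1 / sqrt (1 + a * v) * normal_density 0 (sqrt (2 * a / (1 + a * v))) k" for k
  proof -
    have e: "- k\<^sup>2 / (2 * (2 * a)) - k\<^sup>2 * v / 4 = - k\<^sup>2 / (2 * (2 * a / (1 + a * v)))"
      using a pos by (simp add: field_simps)
    have s: "1 / sqrt (2 * pi * (2 * a)) = 1 / sqrt (1 + a * v) * (1 / sqrt (2 * pi * (2 * a / (1 + a * v))))"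
      using a pos by (simp add: real_sqrt_mult real_sqrt_divide)
    show ?thesis
      using a pos unfolding normal_density_def
      by (simp only: real_sqrt_pow2 less_imp_le zero_less_divide_iff zero_less_mult_iff diff_0_right
          divide_nonneg_pos mult_nonneg_nonneg mult.assoc exp_add[symmetric])
         (use e s in \<open>simp add: exp_add[symmetric]\<close>)
  qed
  then show ?thesis using a pos by simp
qed

lemma borel_measurable_cnj [measurable]: "cnj \<in> borel_measurable borel"
  by (intro borel_measurable_continuous_onI continuous_intros)

lemma norm_Re_iexp_le: "cmod (of_real (Re w) * iexp x) \<le> cmod w"
  using abs_Re_le_cmod[of w] by (simp only: norm_mult norm_of_real norm_exp_i_times mult_1_right)

text \<open>The variables are uncorrelated, hence independent, but only the joint characteristic function is
  used. A moment of \<open>Y\<close> of order above two is what makes \<open>Y / F\<close> integrable by elementary means: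
  \<open>1 / F\<close> has moments of every order below two only.\<close>

locale circ_gauss_pair = prob_space M for M :: "'a measure" +
  fixes F Y :: "'a \<Rightarrow> complex" and v \<tau> :: real
  assumes F_meas [measurable]: "F \<in> borel_measurable M"
    and Y_meas [measurable]: "Y \<in> borel_measurable M"
    and v_pos: "v > 0" and tau_nonneg: "\<tau> \<ge> 0"
    and F_L2: "integrable M (\<lambda>s. (cmod (F s))\<^sup>2)"
    and Y_L2: "integrable M (\<lambda>s. (cmod (Y s))\<^sup>2)"
    and Y_L4: "integrable M (\<lambda>s. (cmod (Y s)) ^ 4)"
    and Y_L4_le: "expectation (\<lambda>s. (cmod (Y s)) ^ 4) \<le> 3 * \<tau>\<^sup>2"
    and char: "\<And>p q. expectation (\<lambda>s. iexp (Re (p * F s + q * Y s)))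
       = of_real (exp (- ((cmod p)\<^sup>2 * v + (cmod q)\<^sup>2 * \<tau>) / 4))"
begin

section \<open>Mixed moments read off the joint characteristic function\<close>

lemma integrable_Y: "integrable M Y"
proof (rule Bochner_Integration.integrable_bound)
  show "integrable M (\<lambda>s. 1 + (cmod (Y s))\<^sup>2)" using Y_L2 by simp
  have "x \<le> 1 + x\<^sup>2" for x :: real using zero_le_power2[of "x - 1 / 2"] by (simp add: power2_diff power_divide)
  then show "AE s in M. norm (Y s) \<le> norm (1 + (cmod (Y s))\<^sup>2)"
    by (auto simp: abs_of_nonneg)
qed simp

lemma integrable_YF:
  assumes [measurable]: "r \<in> borel_measurable M" and r: "\<And>s. cmod (r s) \<le> cmod (F s)"
  shows "integrable M (\<lambda>s. r s * Y s)"
proof (rule Bochner_Integration.integrable_bound)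
  show "integrable M (\<lambda>s. (cmod (F s))\<^sup>2 + (cmod (Y s))\<^sup>2)" using F_L2 Y_L2 by simp
  have "cmod (r s) * cmod (Y s) \<le> (cmod (F s))\<^sup>2 + (cmod (Y s))\<^sup>2" for s
  proof -
    have "cmod (r s) * cmod (Y s) \<le> cmod (F s) * cmod (Y s)" by (intro mult_right_mono r) simp
    also have "\<dots> \<le> (cmod (F s))\<^sup>2 + (cmod (Y s))\<^sup>2"
    proof -
      have "0 \<le> cmod (F s) * cmod (Y s)" by simp
      then show ?thesis using sum_squares_bound[of "cmod (F s)" "cmod (Y s)"] by linarith
    qed
    finally show ?thesis .
  qed
  then show "AE s in M. norm (r s * Y s) \<le> norm ((cmod (F s))\<^sup>2 + (cmod (Y s))\<^sup>2)"
    by (auto simp: norm_mult)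
qed simp

text \<open>Replacing q by t q, the joint characteristic function depends on t only through t^2, so
  its derivative at 0 vanishes.\<close>

lemma expectation_Re_Y_iexp: "expectation (\<lambda>s. of_real (Re (q * Y s)) * iexp (Re (p * F s))) = 0"
proof -
  have "(LINT s|M. \<i> * (of_real (Re (q * Y s)) * iexp (Re (p * F s)))) = 0"
  proof (rule integral_iexp_derivative)
    show "integrable M (\<lambda>s. iexp (Re (p * F s)))"
      by (rule integrable_const_bound[of _ 1]) auto
    show "integrable M (\<lambda>s. of_real (Re (q * Y s)) * iexp (Re (p * F s)))"
    proof (rule Bochner_Integration.integrable_bound)
      show "integrable M (\<lambda>s. q * Y s)" using integrable_Y by simp
      show "AE s in M. cmod (of_real (Re (q * Y s)) * iexp (Re (p * F s))) \<le> cmod (q * Y s)"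
        by (intro AE_I2 norm_Re_iexp_le)
    qed simp
    show "(LINT s|M. iexp (t * Re (q * Y s)) * iexp (Re (p * F s))) =
       of_real (exp (- ((cmod p)\<^sup>2 * v + t\<^sup>2 * (cmod q)\<^sup>2 * \<tau>) / 4))" for t
      using char[of p "of_real t * q"]
      by (simp add: exp_add[symmetric] norm_mult power_mult_distrib algebra_simps)
    show "((\<lambda>t. complex_of_real (exp (- ((cmod p)\<^sup>2 * v + t\<^sup>2 * (cmod q)\<^sup>2 * \<tau>) / 4))) has_vector_derivative 0) (at 0)"
    proof -
      have "((\<lambda>t. exp (- ((cmod p)\<^sup>2 * v + t\<^sup>2 * (cmod q)\<^sup>2 * \<tau>) / 4)) has_real_derivative 0) (at 0)"
        by (auto intro!: derivative_eq_intros)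
      from has_vector_derivative_of_real[OF this] show ?thesis by simp
    qed
  qed simp
  then show ?thesis by simp
qed

lemma expectation_Y_iexp: "expectation (\<lambda>s. Y s * iexp (Re (p * F s))) = 0"
proof -
  have int: "integrable M (\<lambda>s. of_real (Re (q * Y s)) * iexp (Re (p * F s)))" for q
    by (rule Bochner_Integration.integrable_bound[OF integrable_mult_right[OF integrable_Y, of q]])
      (simp, intro AE_I2 norm_Re_iexp_le)
  have "Y s = of_real (Re (1 * Y s)) + \<i> * of_real (Re (- \<i> * Y s))" for s
    by (simp add: complex_eq_iff)
  then have "expectation (\<lambda>s. Y s * iexp (Re (p * F s))) =
     expectation (\<lambda>s. of_real (Re (1 * Y s)) * iexp (Re (p * F s)) + \<i> * (of_real (Re (- \<i> * Y s)) * iexp (Re (p * F s))))"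
    by (intro Bochner_Integration.integral_cong refl) (metis (no_types) distrib_right mult.assoc)
  then show ?thesis
    using int[of 1] int[of "- \<i>"] expectation_Re_Y_iexp[of 1 p] expectation_Re_Y_iexp[of "- \<i>" p] by simp
qed

text \<open>\<open>expectation_Y_iexp\<close> holds for every p, so differentiating it along p + t r
  brings down Re (r F). The choices r = 1 and r = - i give the real and imaginary parts of
  F.\<close>

lemma expectation_Y_cnj_F_iexp: "expectation (\<lambda>s. cnj (F s) * Y s * iexp (Re (p * F s))) = 0"
proof -
  have int: "integrable M (\<lambda>s. of_real (Re (r * F s)) * (Y s * iexp (Re (p * F s))))" if "cmod r = 1" for r
  proof -
    have "integrable M (\<lambda>s. (of_real (Re (r * F s)) * iexp (Re (p * F s))) * Y s)"
      using that norm_Re_iexp_le[of "r * F _"]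
      by (intro integrable_YF) (measurable, metis mult_1 norm_mult)
    then show ?thesis by (simp add: mult_ac)
  qed
  have 0: "expectation (\<lambda>s. of_real (Re (r * F s)) * (Y s * iexp (Re (p * F s)))) = 0" if "cmod r = 1" for r
  proof -
    have "(LINT s|M. \<i> * (of_real (Re (r * F s)) * (Y s * iexp (Re (p * F s))))) = 0"
    proof (rule integral_iexp_derivative)
      show "integrable M (\<lambda>s. Y s * iexp (Re (p * F s)))"
        by (rule Bochner_Integration.integrable_bound[OF integrable_Y]) (auto simp: norm_mult)
      show "(LINT s|M. iexp (t * Re (r * F s)) * (Y s * iexp (Re (p * F s)))) = 0" for t
        using expectation_Y_iexp[of "of_real t * r + p"] by (simp add: exp_add[symmetric] algebra_simps)
    qed (use int[OF that] in auto)
    then show ?thesis by simp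
  qed
  have c: "cmod 1 = 1" "cmod (- \<i>) = 1" by auto
  have "cnj (F s) = of_real (Re (1 * F s)) - \<i> * of_real (Re (- \<i> * F s))" for s
    by (simp add: complex_eq_iff)
  then have "expectation (\<lambda>s. cnj (F s) * Y s * iexp (Re (p * F s))) =
     expectation (\<lambda>s. of_real (Re (1 * F s)) * (Y s * iexp (Re (p * F s))) - \<i> * (of_real (Re (- \<i> * F s)) * (Y s * iexp (Re (p * F s)))))"
    by (intro Bochner_Integration.integral_cong refl) (metis (no_types) left_diff_distrib mult.assoc)
  also have "\<dots> = 0"
    using int[OF c(1)] int[OF c(2)] 0[OF c(1)] 0[OF c(2)]
    by (subst Bochner_Integration.integral_diff) auto
  finally show ?thesis .
qed

text \<open>The one-dimensional damping lemma, once for Re F and once for Im F; the sign in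
  \<open>Complex k (- l)\<close> makes Re (Complex k (- l) F) equal to k Re F + l Im F.\<close>

lemma expectation_damping:
  assumes G: "integrable M G" and a: "a > 0"
  shows "expectation (\<lambda>s. G s * of_real (exp (- a * (cmod (F s))\<^sup>2))) =
    (LINT k|lborel. of_real (normal_density 0 (sqrt (2 * a)) k) * (LINT l|lborel. of_real (normal_density 0 (sqrt (2 * a)) l) *
       expectation (\<lambda>s. G s * iexp (Re (Complex k (- l) * F s)))))"
proof -
  note [measurable] = borel_measurable_integrable[OF G]
  let ?R = "\<lambda>s. of_real (exp (- a * (Re (F s))\<^sup>2))" and ?I = "\<lambda>s. of_real (exp (- a * (Im (F s))\<^sup>2))"
  have GI: "integrable M (\<lambda>s. G s * ?I s)"
    using a by (intro Bochner_Integration.integrable_bound[OF G]) (auto simp: norm_mult intro!: mult_left_le)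
  have Gk: "integrable M (\<lambda>s. G s * iexp (k * Re (F s)))" for k
    by (rule Bochner_Integration.integrable_bound[OF G]) (auto simp: norm_mult)
  have "expectation (\<lambda>s. G s * of_real (exp (- a * (cmod (F s))\<^sup>2))) = expectation (\<lambda>s. G s * ?I s * ?R s)"
    by (intro Bochner_Integration.integral_cong refl)
       (simp add: cmod_power2 algebra_simps exp_add[symmetric] flip: of_real_mult exp_of_real)
  also have "\<dots> = (LINT k|lborel. of_real (normal_density 0 (sqrt (2 * a)) k) * (LINT s|M. G s * ?I s * iexp (k * Re (F s))))"
    using GI a by (intro integral_gauss_damping) auto
  also have "(\<lambda>k. LINT s|M. G s * ?I s * iexp (k * Re (F s))) = (\<lambda>k. LINT s|M. G s * iexp (k * Re (F s)) * ?I s)"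
    by (simp add: mult_ac)
  also have "\<dots> = (\<lambda>k. LINT l|lborel. of_real (normal_density 0 (sqrt (2 * a)) l) * (LINT s|M. G s * iexp (k * Re (F s)) * iexp (l * Im (F s))))"
    using Gk a by (intro ext integral_gauss_damping) auto
  finally show ?thesis
    by (simp add: exp_add[symmetric] mult.assoc algebra_simps)
qed

text \<open>This is the Laplace transform of the exponential law with mean v; the real and imaginary
  parts contribute a factor 1 / sqrt (1 + a v) each.\<close>

lemma expectation_exp_norm_square:
  assumes a: "a > 0"
  shows "expectation (\<lambda>s. exp (- a * (cmod (F s))\<^sup>2)) = 1 / (1 + a * v)"
proof -
  have *: "of_real (expectation (\<lambda>s. exp (- a * (cmod (F s))\<^sup>2))) = complex_of_real (1 / (1 + a * v))"
  proof -
    have ch: "expectation (\<lambda>s. 1 * iexp (Re (Complex k (- l) * F s))) = of_real (exp (- (k\<^sup>2 * v / 4)) * exp (- (l\<^sup>2 * v / 4)))" for k l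
      using char[of "Complex k (- l)" 0] by (simp add: cmod_power2 field_simps flip: exp_add)
    have "complex_of_real (expectation (\<lambda>s. exp (- a * (cmod (F s))\<^sup>2))) = expectation (\<lambda>s. 1 * of_real (exp (- a * (cmod (F s))\<^sup>2)))"
      by simp
    also have "\<dots> = (LINT k|lborel. of_real (normal_density 0 (sqrt (2 * a)) k) * (LINT l|lborel. of_real (normal_density 0 (sqrt (2 * a)) l) *
         of_real (exp (- (k\<^sup>2 * v / 4)) * exp (- (l\<^sup>2 * v / 4)))))"
      unfolding ch[symmetric] by (rule expectation_damping) (use a in auto)
    also have "\<dots> = of_real (LINT k|lborel. normal_density 0 (sqrt (2 * a)) k * (LINT l|lborel. normal_density 0 (sqrt (2 * a)) l *
         (exp (- (k\<^sup>2 * v / 4)) * exp (- (l\<^sup>2 * v / 4)))))"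
      by (simp flip: of_real_mult integral_of_real)
    also have "(\<lambda>k. (LINT l|lborel. normal_density 0 (sqrt (2 * a)) l * (exp (- (k\<^sup>2 * v / 4)) * exp (- (l\<^sup>2 * v / 4))))) =
       (\<lambda>k. exp (- (k\<^sup>2 * v / 4)) * (1 / sqrt (1 + a * v)))"
      using integral_normal_exp_square[OF a, of v] v_pos
      by (auto simp: fun_eq_iff mult.left_commute[of _ "exp (- (_\<^sup>2 * v / 4))"])
    also have "(LINT k|lborel. normal_density 0 (sqrt (2 * a)) k * (exp (- (k\<^sup>2 * v / 4)) * (1 / sqrt (1 + a * v)))) = 1 / (1 + a * v)"
      using integral_normal_exp_square[OF a, of v] v_pos a
      by (simp add: mult.assoc[symmetric] add_nonneg_nonneg)
    finally show ?thesis .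
  qed
  then show ?thesis by (simp only: of_real_eq_iff)
qed

text \<open>Markov's inequality for \<open>exp (- \<bar>F\<bar>\<^sup>2 / \<delta>\<^sup>2)\<close>.\<close>

lemma prob_norm_le:
  assumes "\<delta> > 0"
  shows "prob {s \<in> space M. cmod (F s) \<le> \<delta>} \<le> 3 * \<delta>\<^sup>2 / v"
proof -
  let ?a = "1 / \<delta>\<^sup>2"
  have a: "?a > 0" using assms by simp
  have int: "integrable M (\<lambda>s. exp (- ?a * (cmod (F s))\<^sup>2))"
    by (rule integrable_const_bound[of _ 1]) auto
  have "prob {s \<in> space M. cmod (F s) \<le> \<delta>} = expectation (indicator {s \<in> space M. cmod (F s) \<le> \<delta>})"
    by simp
  also have "\<dots> \<le> expectation (\<lambda>s. exp 1 * exp (- ?a * (cmod (F s))\<^sup>2))"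
  proof (rule integral_mono)
    show "integrable M (\<lambda>s. exp 1 * exp (- ?a * (cmod (F s))\<^sup>2))" using int by (intro integrable_mult_right)
    fix s assume "s \<in> space M"
    show "indicator {s \<in> space M. cmod (F s) \<le> \<delta>} s \<le> exp 1 * exp (- ?a * (cmod (F s))\<^sup>2)"
    proof (cases "cmod (F s) \<le> \<delta>")
      case True
      then have "(cmod (F s))\<^sup>2 \<le> \<delta>\<^sup>2" by (intro power_mono) auto
      then have "0 \<le> 1 + - ?a * (cmod (F s))\<^sup>2" using assms by (simp add: field_simps)
      then have "1 \<le> exp (1 + - ?a * (cmod (F s))\<^sup>2)" by simp
      then show ?thesis using True by (simp only: exp_add indicator_simps) (simp add: indicator_def)
    qed simp
  next
    show "integrable M (indicat_real {s \<in> space M. cmod (F s) \<le> \<delta>})"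
      by (rule integrable_const_bound[of _ 1]) auto
  qed
  also have "\<dots> = exp 1 * (1 / (1 + ?a * v))"
    using expectation_exp_norm_square[OF a] by simp
  also have "\<dots> \<le> 3 * (\<delta>\<^sup>2 / v)"
  proof (intro mult_mono)
    show "exp 1 \<le> (3::real)" by (rule exp_le)
    have "1 / (1 + ?a * v) \<le> 1 / (?a * v)" using mult_pos_pos[OF a v_pos] by (intro frac_le) auto
    then show "1 / (1 + ?a * v) \<le> \<delta>\<^sup>2 / v" by simp
  qed (use assms v_pos in \<open>auto intro!: add_nonneg_nonneg\<close>)
  finally show ?thesis by simp
qed

text \<open>Resolving \<open>\<bar>F\<bar>\<close> on the scale \<open>1 / 8 ^ n\<close>, bound \<open>\<bar>Y / F\<bar>\<close> by a multiple of
  \<open>1 + \<bar>Y\<bar>\<^sup>4 + \<bar>F\<bar> powr (- 4/3)\<close>.\<close>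

lemma nn_expectation_ratio_le:
  "(\<integral>\<^sup>+ s. ennreal (cmod (Y s / F s)) \<partial>M) \<le> ennreal (3 * \<tau>\<^sup>2 + 1 + 64 / v)"
proof -
  define A where "A n = {s \<in> space M. cmod (F s) \<le> 1 / 8 ^ n}" for n :: nat
  have [measurable]: "A n \<in> sets M" for n unfolding A_def by measurable
  have pA: "prob (A n) \<le> 3 * (1 / 64) ^ n / v" for n
  proof -
    have "(1 / 8 ^ n)\<^sup>2 = ((1 / 64) ^ n :: real)"
      by (simp add: power_divide power2_eq_square flip: power_mult_distrib)
    then show ?thesis using prob_norm_le[of "1 / 8 ^ n"] unfolding A_def by simp
  qed
  have term_le: "f n \<le> suminf f" for f :: "nat \<Rightarrow> ennreal" and n
    using sum_le_suminf[of f "{n}"] by (simp add: summableI)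
  have "ennreal (cmod (Y s / F s)) \<le> ennreal ((cmod (Y s)) ^ 4) + 1 + (\<Sum>n. ennreal (16 ^ Suc n) * indicator (A n) s)"
    if s: "s \<in> space M" for s
  \<comment> \<open>Division by 0 yields 0, so a vanishing F is harmless here and can be treated
    together with large F.\<close>
  proof (cases "F s = 0 \<or> cmod (F s) > 1")
    case True
    then have "cmod (Y s / F s) \<le> cmod (Y s)"
      by (auto simp: norm_divide divide_le_eq mult_le_cancel_left1)
    also have "\<dots> \<le> cmod (Y s) ^ 4 + 1"
      using self_le_power[of "cmod (Y s)" 4] by (cases "cmod (Y s) \<ge> 1") (auto intro: add_increasing2 add_increasing)
    finally have "ennreal (cmod (Y s / F s)) \<le> ennreal ((cmod (Y s)) ^ 4 + 1)" by (rule ennreal_leI)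
    also have "\<dots> = ennreal ((cmod (Y s)) ^ 4) + 1" by (simp add: ennreal_plus)
    finally show ?thesis by (rule order_trans) (simp add: add_increasing2)
  next
    case False
    define y where "y = cmod (F s)"
    have y: "0 < y" "y \<le> 1" using False by (auto simp: y_def)
    obtain m where "1 / 8 ^ m < y"
      using real_arch_pow_inv[OF y(1), of "1/8"] by (auto simp: power_divide)
    then have "\<exists>n. 1 / 8 ^ n < y" by blast
    define m where "m = (LEAST n. 1 / 8 ^ n < y)"
    have m: "1 / 8 ^ m < y" unfolding m_def by (rule LeastI_ex) fact
    have "m \<noteq> 0" using m y by (intro notI) simp
    then obtain n where n: "m = Suc n" by (cases m) auto
    have n': "y \<le> 1 / 8 ^ n" using not_less_Least[of n "\<lambda>n. 1 / 8 ^ n < y"] n unfolding m_def by (auto simp: not_less)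
    have "cmod (Y s / F s) \<le> cmod (Y s) * 8 ^ Suc n"
    proof -
      have "1 / y \<le> 8 ^ Suc n" using m y unfolding n by (simp add: field_simps)
      then have "cmod (Y s) * (1 / y) \<le> cmod (Y s) * 8 ^ Suc n" by (rule mult_left_mono) simp
      then show ?thesis by (simp add: norm_divide y_def)
    qed
    also have "\<dots> \<le> (cmod (Y s)) ^ 4 + 16 ^ Suc n"
    \<comment> \<open>The threshold balances the two bounds: below it, |Y| 8^(n+1) is at most
      16^(n+1); above it, 8^(n+1) is at most |Y|^3.\<close>
    proof (cases "cmod (Y s) \<le> 2 ^ Suc n")
      case True
      then have "cmod (Y s) * 8 ^ Suc n \<le> 2 ^ Suc n * 8 ^ Suc n" by (intro mult_right_mono) auto
      also have "\<dots> = 16 ^ Suc n" by (simp flip: power_mult_distrib)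
      finally show ?thesis by (simp add: add_increasing)
    next
      case False
      then have "(2 ^ Suc n) ^ 3 \<le> cmod (Y s) ^ 3" by (intro power_mono) auto
      moreover have "(2 ^ Suc n) ^ 3 = ((2::real) ^ 3) ^ Suc n" by (simp only: power_mult[symmetric] mult.commute)
      ultimately have "8 ^ Suc n \<le> cmod (Y s) ^ 3" by simp
      then have "cmod (Y s) * 8 ^ Suc n \<le> cmod (Y s) * cmod (Y s) ^ 3" by (intro mult_left_mono) auto
      also have "\<dots> = cmod (Y s) ^ 4" by (simp add: eval_nat_numeral)
      finally show ?thesis by (simp add: add_increasing2)
    qed
    finally have "ennreal (cmod (Y s / F s)) \<le> ennreal ((cmod (Y s)) ^ 4 + 16 ^ Suc n)" by (rule ennreal_leI)
    also have "\<dots> = ennreal ((cmod (Y s)) ^ 4) + ennreal (16 ^ Suc n) * indicator (A n) s"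
      using n' s by (simp add: A_def y_def)
    also have "\<dots> \<le> ennreal ((cmod (Y s)) ^ 4) + (\<Sum>n. ennreal (16 ^ Suc n) * indicator (A n) s)"
      by (intro add_mono order.refl term_le)
    finally show ?thesis by (rule order_trans) (simp add: add_increasing add_mono)
  qed
  then have "(\<integral>\<^sup>+ s. ennreal (cmod (Y s / F s)) \<partial>M) \<le>
     (\<integral>\<^sup>+ s. ennreal ((cmod (Y s)) ^ 4) + 1 + (\<Sum>n. ennreal (16 ^ Suc n) * indicator (A n) s) \<partial>M)"
    by (rule nn_integral_mono)
  also have "\<dots> = (\<integral>\<^sup>+ s. ennreal ((cmod (Y s)) ^ 4) \<partial>M) + 1 + (\<Sum>n. ennreal (16 ^ Suc n) * emeasure M (A n))"
    by (simp add: nn_integral_add nn_integral_suminf nn_integral_cmult emeasure_space_1)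
  also have "(\<integral>\<^sup>+ s. ennreal ((cmod (Y s)) ^ 4) \<partial>M) \<le> ennreal (3 * \<tau>\<^sup>2)"
    using Y_L4 Y_L4_le by (subst nn_integral_eq_integral) (auto intro!: ennreal_leI)
  \<comment> \<open>The weight 16^(n+1) meets the probability bound 3 * 64^-n / v, leaving a
    geometric series of ratio 1/4 with first term 48 / v and sum 64 / v.\<close>
  also have "(\<Sum>n. ennreal (16 ^ Suc n) * emeasure M (A n)) \<le> (\<Sum>n. ennreal (48 / v * (1 / 4) ^ n))"
  proof (intro suminf_le)
    fix n
    have "ennreal (16 ^ Suc n) * emeasure M (A n) = ennreal (16 ^ Suc n * prob (A n))"
      by (simp add: emeasure_eq_measure ennreal_mult)
    also have "16 ^ Suc n * prob (A n) \<le> 16 ^ Suc n * (3 * (1 / 64) ^ n / v)"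
      by (intro mult_left_mono pA) auto
    also have "16 ^ Suc n * (3 * (1 / 64) ^ n / v) = 48 / v * (16 * (1 / 64)) ^ n"
      by (simp only: power_mult_distrib power_Suc) simp
    finally show "ennreal (16 ^ Suc n) * emeasure M (A n) \<le> ennreal (48 / v * (1 / 4) ^ n)"
      by (simp add: ennreal_leI)
  qed auto
  also have "(\<Sum>n. ennreal (48 / v * (1 / 4) ^ n)) = ennreal (64 / v)"
    using v_pos sums_mult[OF geometric_sums[of "1/4::real"], of "48 / v"]
    by (intro suminf_ennreal_eq) auto
  finally show ?thesis
    using v_pos by (simp add: ennreal_plus flip: ennreal_1)
qed

lemma integrable_ratio: "integrable M (\<lambda>s. Y s / F s)"
  unfolding integrable_iff_bounded
  using le_less_trans[OF nn_expectation_ratio_le ennreal_less_top] by auto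

lemma AE_F_nonzero: "AE s in M. F s \<noteq> 0"
proof -
  have "prob {s \<in> space M. F s = 0} \<le> 3 * (1 / real (Suc n))\<^sup>2 / v" for n
    by (rule order_trans[OF finite_measure_mono prob_norm_le[of "1 / real (Suc n)"]]) auto
  moreover have "(\<lambda>n. 3 * (1 / real (Suc n))\<^sup>2 / v) \<longlonglongrightarrow> 0"
    using tendsto_mult[OF tendsto_const[of "3 / v"] tendsto_power[OF LIMSEQ_inverse_real_of_nat, of 2]]
    by (simp add: inverse_eq_divide)
  ultimately have "prob {s \<in> space M. F s = 0} \<le> 0"
    by (intro LIMSEQ_le_const[of _ 0]) auto
  then have "prob {s \<in> space M. F s = 0} = 0" using measure_nonneg by (rule antisym)
  then show ?thesis by (subst AE_iff_measurable[OF _ refl]) (auto simp: emeasure_eq_measure)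
qed

text \<open>Integrate \<open>E (cnj F * Y * exp (- a \<bar>F\<bar>\<^sup>2)) = 0\<close> over \<open>a > 0\<close>.\<close>

lemma expectation_ratio: "expectation (\<lambda>s. Y s / F s) = 0"
proof -
  interpret P: pair_sigma_finite M lborel ..
  \<comment> \<open>For F nonzero the density of rate |F|^2 integrates to 1 over a, so the integral
    of f over a returns Y / F; its prefactor |F|^2 = F cnj F cancels the denominator and leaves cnj
    F * Y with Gaussian damping.\<close>
  define f where "f s a = Y s / F s * of_real (exponential_density ((cmod (F s))\<^sup>2) a)" for s a
  have [measurable]: "case_prod f \<in> borel_measurable (M \<Otimes>\<^sub>M lborel)"
    unfolding f_def exponential_density_def by measurable
  have dens: "integrable lborel (exponential_density l)" "(LINT a|lborel. exponential_density l a) = 1" if "l > 0" for l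
  proof -
    have "has_bochner_integral lborel (exponential_density l) 1"
      using that prob_space.emeasure_space_1[OF prob_space_exponential_density[OF that]]
      by (intro has_bochner_integral_nn_integral) (auto simp: exponential_density_nonneg emeasure_density)
    then show "integrable lborel (exponential_density l)" "(LINT a|lborel. exponential_density l a) = 1"
      by (auto simp: has_bochner_integral_iff)
  qed
  have "(LINT a|lborel. LINT s|M. f s a) = (LINT s|M. LINT a|lborel. f s a)"
  proof (rule P.Fubini_integral, rule P.Fubini_integrable)
    have "AE s in M. (LINT a|lborel. norm (case_prod f (s, a))) = cmod (Y s / F s)"
      using AE_F_nonzero
    proof eventually_elim
      case (elim s)
      then have "norm (case_prod f (s, a)) = cmod (Y s / F s) * exponential_density ((cmod (F s))\<^sup>2) a" for a
        by (simp add: f_def norm_mult norm_divide exponential_density_nonneg)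
      then show ?case using elim by (simp add: dens)
    qed
    then show "integrable M (\<lambda>s. LINT a|lborel. norm (case_prod f (s, a)))"
      by (subst integrable_cong_AE[where g = "\<lambda>s. cmod (Y s / F s)"]) (auto intro: integrable_norm integrable_ratio)
    show "AE s in M. integrable lborel (\<lambda>a. case_prod f (s, a))"
      using AE_F_nonzero
      by eventually_elim (unfold f_def prod.case, intro integrable_mult_right integrable_of_real dens, simp)
  qed simp
  also have "\<dots> = expectation (\<lambda>s. Y s / F s)"
  proof (rule integral_cong_AE)
    show "AE s in M. (LINT a|lborel. f s a) = Y s / F s"
      using AE_F_nonzero by eventually_elim (simp add: f_def dens)
  qed auto
  finally have swap: "(LINT a|lborel. LINT s|M. f s a) = expectation (\<lambda>s. Y s / F s)" .
  have zero: "(LINT s|M. f s a) = 0" if "a \<noteq> 0" for a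
  proof (cases "a < 0")
    case True
    then show ?thesis by (simp add: f_def exponential_density_def)
  next
    case False
    with that have a: "a > 0" by simp
    have "f s a = cnj (F s) * Y s * of_real (exp (- a * (cmod (F s))\<^sup>2))" for s
    proof -
      have "f s a = Y s / F s * (F s * cnj (F s)) * of_real (exp (- a * (cmod (F s))\<^sup>2))"
        using a unfolding f_def complex_norm_square[symmetric] by (simp add: exponential_density_def mult_ac)
      then show ?thesis by simp
    qed
    then have "(LINT s|M. f s a) = expectation (\<lambda>s. cnj (F s) * Y s * of_real (exp (- a * (cmod (F s))\<^sup>2)))"
      by simp
    also have "\<dots> = 0"
      using expectation_damping[OF integrable_YF[of "\<lambda>s. cnj (F s)"] a]
      by (simp only: expectation_Y_cnj_F_iexp) simp
    finally show ?thesis .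
  qed
  have "(LINT a|lborel. LINT s|M. f s a) = (LINT a::real|lborel. 0)"
  proof (rule integral_cong_AE)
    show "AE a in lborel. (LINT s|M. f s a) = 0"
      using AE_lborel_singleton[of 0] by eventually_elim (rule zero)
  qed auto
  then show ?thesis using swap by simp
qed

end

section \<open>Circularly symmetric Gaussian vectors\<close>

text \<open>\<open>gaussian_rv\<close> admits constants. Centring forces such a constant to be 0,
  and the formulas in terms of the second moment then cover the degenerate and the density case
  alike.\<close>

lemma (in prob_space)
  assumes g: "gaussian_rv M X" and E0: "expectation X = 0"
  shows gaussian_rv_char: "expectation (\<lambda>s. iexp (X s)) = of_real (exp (- expectation (\<lambda>s. (X s)\<^sup>2) / 2))"
    and gaussian_rv_moment4_integrable: "integrable M (\<lambda>s. (X s) ^ 4)"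
    and gaussian_rv_moment4: "expectation (\<lambda>s. (X s) ^ 4) = 3 * (expectation (\<lambda>s. (X s)\<^sup>2))\<^sup>2"
proof -
  have "expectation (\<lambda>s. iexp (X s)) = of_real (exp (- expectation (\<lambda>s. (X s)\<^sup>2) / 2)) \<and>
    integrable M (\<lambda>s. (X s) ^ 4) \<and> expectation (\<lambda>s. (X s) ^ 4) = 3 * (expectation (\<lambda>s. (X s)\<^sup>2))\<^sup>2"
    using g unfolding gaussian_rv_def
  proof (elim disjE exE conjE)
    fix \<mu> assume [measurable]: "X \<in> borel_measurable M" and ae: "AE s in M. X s = \<mu>"
    have "expectation X = expectation (\<lambda>s. \<mu>)"
      using ae by (intro integral_cong_AE) auto
    with E0 have "\<mu> = 0" by (simp add: prob_space)
    with ae have ae: "AE s in M. X s = 0" by simp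
    have "expectation (\<lambda>s. iexp (X s)) = expectation (\<lambda>s. 1)"
      using ae by (intro integral_cong_AE) auto
    moreover have "expectation (\<lambda>s. (X s)\<^sup>2) = expectation (\<lambda>s. 0)"
      using ae by (intro integral_cong_AE) auto
    moreover have "expectation (\<lambda>s. (X s) ^ 4) = expectation (\<lambda>s. 0)"
      using ae by (intro integral_cong_AE) auto
    moreover have "integrable M (\<lambda>s. (X s) ^ 4)"
      using ae by (subst integrable_cong_AE[where g = "\<lambda>s. 0"]) auto
    ultimately show ?thesis by (simp add: prob_space)
  next
    fix \<mu> \<sigma> :: real assume \<sigma>: "0 < \<sigma>" and D: "distributed M lborel X (\<lambda>x. ennreal (normal_density \<mu> \<sigma> x))"
    have [measurable]: "X \<in> borel_measurable M" using distributed_measurable[OF D] by simp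
    have "\<mu> = 0" using normal_distributed_expectation[OF \<sigma> D] E0 by simp
    note D = D[unfolded this]
    have m: "expectation (\<lambda>s. (X s) ^ (2 * k)) = fact (2 * k) / ((2 / \<sigma>\<^sup>2) ^ k * fact k)" for k
      using integral_normal_moment_even[OF \<sigma>, of 0 k] distributed_integral[OF D, of "\<lambda>x. x ^ (2 * k)"] by simp
    have "expectation (\<lambda>s. iexp (X s)) = integral\<^sup>L (distr M lborel X) iexp"
      by (subst integral_distr) auto
    also have "\<dots> = (LINT x|lborel. of_real (normal_density 0 \<sigma> x) * iexp (1 * x))"
      unfolding distributed_distr_eq_density[OF D] by (subst integral_density) (auto simp: scaleR_conv_of_real)
    also have "\<dots> = of_real (exp (- \<sigma>\<^sup>2 / 2))"
      by (subst has_bochner_integral_integral_eq[OF has_bochner_integral_normal_iexp[OF \<sigma>]]) (simp add: exp_of_real[symmetric])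
    finally have 1: "expectation (\<lambda>s. iexp (X s)) = of_real (exp (- \<sigma>\<^sup>2 / 2))" .
    have 2: "expectation (\<lambda>s. (X s)\<^sup>2) = \<sigma>\<^sup>2" using m[of 1] by (simp add: eval_nat_numeral)
    have 3: "expectation (\<lambda>s. (X s) ^ 4) = 3 * (\<sigma>\<^sup>2)\<^sup>2" using m[of 2] \<sigma> by (simp add: fact_numeral power_divide)
    have 4: "integrable M (\<lambda>s. (X s) ^ 4)"
      using integrable_normal_moment[OF \<sigma>, of 0 4] distributed_integrable[OF D, of "\<lambda>x. x ^ 4"] by simp
    show ?thesis using 1 2 3 4 by simp
  qed
  then show "expectation (\<lambda>s. iexp (X s)) = of_real (exp (- expectation (\<lambda>s. (X s)\<^sup>2) / 2))"
    "integrable M (\<lambda>s. (X s) ^ 4)" "expectation (\<lambda>s. (X s) ^ 4) = 3 * (expectation (\<lambda>s. (X s)\<^sup>2))\<^sup>2"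
    by blast+
qed

lemma integrable_mult_L2:
  fixes A B :: "'a \<Rightarrow> complex"
  assumes [measurable]: "A \<in> borel_measurable M" "B \<in> borel_measurable M"
    and A: "integrable M (\<lambda>s. (cmod (A s))\<^sup>2)" and B: "integrable M (\<lambda>s. (cmod (B s))\<^sup>2)"
  shows "integrable M (\<lambda>s. A s * B s)"
proof (rule Bochner_Integration.integrable_bound)
  show "integrable M (\<lambda>s. (cmod (A s))\<^sup>2 + (cmod (B s))\<^sup>2)" using A B by simp
  have "cmod (A s * B s) \<le> (cmod (A s))\<^sup>2 + (cmod (B s))\<^sup>2" for s
  proof -
    have "0 \<le> cmod (A s) * cmod (B s)" by simp
    then show ?thesis using sum_squares_bound[of "cmod (A s)" "cmod (B s)"] unfolding norm_mult by linarith
  qed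
  then show "AE s in M. norm (A s * B s) \<le> norm ((cmod (A s))\<^sup>2 + (cmod (B s))\<^sup>2)" by auto
qed simp

lemma circ_sym_gaussian_rotate:
  fixes g :: "(nat \<Rightarrow> complex) \<Rightarrow> 'b::{banach, second_countable_topology}"
  assumes Z: "circ_sym_gaussian M n Z" and g[measurable]: "g \<in> borel_measurable (Pi\<^sub>M {..<n} (\<lambda>_. borel))"
  shows "(LINT s|M. g (\<lambda>i\<in>{..<n}. cis \<theta> * Z i s)) = (LINT s|M. g (\<lambda>i\<in>{..<n}. Z i s))"
proof -
  have Z': "Z i \<in> borel_measurable M" if "i < n" for i using Z that by (auto simp: circ_sym_gaussian_def)
  have m1: "(\<lambda>s. \<lambda>i\<in>{..<n}. cis \<theta> * Z i s) \<in> measurable M (Pi\<^sub>M {..<n} (\<lambda>_. borel))"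
    by (rule measurable_restrict) (use Z' in \<open>auto intro!: borel_measurable_times\<close>)
  have m2: "(\<lambda>s. \<lambda>i\<in>{..<n}. Z i s) \<in> measurable M (Pi\<^sub>M {..<n} (\<lambda>_. borel))"
    by (rule measurable_restrict) (use Z' in auto)
  have eq: "distr M (Pi\<^sub>M {..<n} (\<lambda>_. borel)) (\<lambda>s. \<lambda>i\<in>{..<n}. cis \<theta> * Z i s) =
          distr M (Pi\<^sub>M {..<n} (\<lambda>_. borel)) (\<lambda>s. \<lambda>i\<in>{..<n}. Z i s)"
    using Z unfolding circ_sym_gaussian_def by blast
  show ?thesis
    using integral_distr[OF m1 g] integral_distr[OF m2 g] unfolding eq by simp
qed

text \<open>Rotation by pi / 2 multiplies the product by i^2 = -1 without changing its
  expectation.\<close>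

lemma circ_sym_gaussian_pseudo_covariance:
  assumes Z: "circ_sym_gaussian M n Z" and ij: "i < n" "j < n"
  shows "(LINT s|M. Z i s * Z j s) = 0"
proof -
  have "(\<lambda>x. x i * x j :: complex) \<in> borel_measurable (Pi\<^sub>M {..<n} (\<lambda>_. borel))"
    using ij by (intro borel_measurable_times measurable_component_singleton) auto
  from circ_sym_gaussian_rotate[OF Z this, of "pi / 2"] ij
  have "(LINT s|M. - (Z i s * Z j s)) = (LINT s|M. Z i s * Z j s)"
    by (simp add: mult_ac)
  then show ?thesis by simp
qed

lemma circ_sym_gaussian_mean:
  assumes Z: "circ_sym_gaussian M n Z" and i: "i < n"
  shows "(LINT s|M. Z i s) = 0"
proof -
  have "(\<lambda>x. x i :: complex) \<in> borel_measurable (Pi\<^sub>M {..<n} (\<lambda>_. borel))"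
    using i by (intro measurable_component_singleton) auto
  from circ_sym_gaussian_rotate[OF Z this, of pi] i
  have "(LINT s|M. - Z i s) = (LINT s|M. Z i s)" by simp
  then show ?thesis by simp
qed

text \<open>Linear regression of \<open>Z 1\<close> on \<open>Z 0\<close>: h is the regression
  coefficient, Y the residual orthogonal to \<open>Z 0\<close>, and the last hypothesis is
  Pythagoras with \<tau> = E|Y|^2. Joint Gaussianity turns second moments into the joint
  characteristic function.\<close>

lemma (in prob_space) circ_gauss_pairI:
  assumes Z: "circ_sym_gaussian M 2 Z"
    and L2: "\<And>i. i < 2 \<Longrightarrow> integrable M (\<lambda>s. (cmod (Z i s))\<^sup>2)"
    and v: "expectation (\<lambda>s. Z 0 s * cnj (Z 0 s)) = of_real v" and "v > 0"
    and h: "expectation (\<lambda>s. Z 1 s * cnj (Z 0 s)) = h * of_real v"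
    and \<tau>: "expectation (\<lambda>s. Z 1 s * cnj (Z 1 s)) = of_real (\<tau> + (cmod h)\<^sup>2 * v)"
  shows "circ_gauss_pair M (Z 0) (\<lambda>s. Z 1 s - h * Z 0 s) v \<tau>"
proof -
  define Y where "Y s = Z 1 s - h * Z 0 s" for s
  have meas [measurable]: "Z 0 \<in> borel_measurable M" "Z 1 \<in> borel_measurable M"
    using Z by (auto simp: circ_sym_gaussian_def)
  have Ym [measurable]: "Y \<in> borel_measurable M" unfolding Y_def by measurable
  have L2': "integrable M (\<lambda>s. (cmod (cnj (Z i s)))\<^sup>2)" if "i < 2" for i using L2[OF that] by simp
  have prods: "integrable M (\<lambda>s. Z i s * Z j s)" "integrable M (\<lambda>s. Z i s * cnj (Z j s))" if "i < 2" "j < 2" for i j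
    using that Z by (auto simp: circ_sym_gaussian_def intro!: integrable_mult_L2 L2 L2')
  note prods' = prods[of 0 0, simplified] prods[of 0 1, simplified] prods[of 1 0, simplified] prods[of 1 1, simplified]
  have h': "expectation (\<lambda>s. Z 0 s * cnj (Z 1 s)) = cnj h * of_real v"
  proof -
    have "expectation (\<lambda>s. Z 0 s * cnj (Z 1 s)) = expectation (\<lambda>s. cnj (Z 1 s * cnj (Z 0 s)))" by (simp add: mult.commute)
    also have "\<dots> = cnj (h * of_real v)" by (simp only: Bochner_Integration.integral_cnj h)
    finally show ?thesis by simp
  qed
  have YF: "expectation (\<lambda>s. Y s * cnj (Z 0 s)) = 0"
    using prods' h v by (simp add: Y_def left_diff_distrib mult.assoc)
  have FY: "expectation (\<lambda>s. Z 0 s * cnj (Y s)) = 0"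
    using prods' h' v by (simp add: Y_def right_diff_distrib mult.left_commute)
  have YY: "expectation (\<lambda>s. Y s * cnj (Y s)) = of_real \<tau>"
  proof -
    have "expectation (\<lambda>s. Y s * cnj (Y s)) = expectation (\<lambda>s. Z 1 s * cnj (Z 1 s) - h * (Z 0 s * cnj (Z 1 s))
       - cnj h * (Z 1 s * cnj (Z 0 s)) + h * cnj h * (Z 0 s * cnj (Z 0 s)))"
      by (simp add: Y_def algebra_simps)
    also have "\<dots> = of_real \<tau>"
      using prods' h' v h \<tau> by (simp add: complex_norm_square[symmetric] algebra_simps)
    finally show ?thesis .
  qed
  have intYF: "integrable M (\<lambda>s. Y s * cnj (Z 0 s))" "integrable M (\<lambda>s. Z 0 s * cnj (Y s))" "integrable M (\<lambda>s. Y s * cnj (Y s))"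
    using prods' by (simp_all add: Y_def algebra_simps)
  have gauss: "gaussian_rv M (\<lambda>s. Re (p * Z 0 s + q * Y s))"
    and mean: "expectation (\<lambda>s. Re (p * Z 0 s + q * Y s)) = 0"
    and var: "expectation (\<lambda>s. (Re (p * Z 0 s + q * Y s))\<^sup>2) = ((cmod p)\<^sup>2 * v + (cmod q)\<^sup>2 * \<tau>) / 2" for p q
  proof -
    \<comment> \<open>The coefficients of p F + q Y in terms of \<open>Z 0\<close> and
      \<open>Z 1\<close>, since Y = Z 1 - h Z 0.\<close>
    define c where "c = (\<lambda>i::nat. if i = 0 then p - q * h else q)"
    have w: "p * Z 0 s + q * Y s = c 0 * Z 0 s + c 1 * Z 1 s" for s by (simp add: c_def Y_def algebra_simps)
    have G: "gaussian_rv M (\<lambda>s. \<Sum>i<2. u i * Re (Z i s) + v i * Im (Z i s))" for u v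
      using Z unfolding circ_sym_gaussian_def by blast
    have eq: "Re (p * Z 0 s + q * Y s) = (\<Sum>i<2. Re (c i) * Re (Z i s) + (- Im (c i)) * Im (Z i s))" for s
      unfolding w by (simp add: eval_nat_numeral)
    show "gaussian_rv M (\<lambda>s. Re (p * Z 0 s + q * Y s))"
      unfolding eq by (rule G)
    have i1: "integrable M (\<lambda>s. Z i s)" if "i < 2" for i
      using that Z integrable_mult_L2[of "Z i" M "\<lambda>_. 1"] L2[OF that] by (auto simp: circ_sym_gaussian_def)
    have "expectation (\<lambda>s. Re (c 0 * Z 0 s + c 1 * Z 1 s)) = Re (expectation (\<lambda>s. c 0 * Z 0 s + c 1 * Z 1 s))"
      using i1[of 0] i1[of 1] by (intro integral_Re) auto
    also have "\<dots> = 0" using i1[of 0] i1[of 1] circ_sym_gaussian_mean[OF Z, of 0] circ_sym_gaussian_mean[OF Z, of 1] by simp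
    finally show "expectation (\<lambda>s. Re (p * Z 0 s + q * Y s)) = 0" unfolding w .
    let ?w = "\<lambda>s. p * Z 0 s + q * Y s"
    have sq: "?w s * ?w s = (c 0)\<^sup>2 * (Z 0 s * Z 0 s) + 2 * c 0 * c 1 * (Z 0 s * Z 1 s) + (c 1)\<^sup>2 * (Z 1 s * Z 1 s)" for s
      unfolding w by (simp add: power2_eq_square algebra_simps)
    have i2: "integrable M (\<lambda>s. ?w s * ?w s)" unfolding sq using prods' by auto
    have e2: "expectation (\<lambda>s. ?w s * ?w s) = 0"
      unfolding sq using prods' circ_sym_gaussian_pseudo_covariance[OF Z, of 0 0] circ_sym_gaussian_pseudo_covariance[OF Z, of 0 1]
        circ_sym_gaussian_pseudo_covariance[OF Z, of 1 1] by simp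
    have ab: "?w s * cnj (?w s) = p * cnj p * (Z 0 s * cnj (Z 0 s)) + p * cnj q * (Z 0 s * cnj (Y s))
        + q * cnj p * (Y s * cnj (Z 0 s)) + q * cnj q * (Y s * cnj (Y s))" for s
      by (simp add: algebra_simps)
    have i3: "integrable M (\<lambda>s. ?w s * cnj (?w s))" unfolding ab using prods' intYF by auto
    have e3: "expectation (\<lambda>s. ?w s * cnj (?w s)) = of_real ((cmod p)\<^sup>2 * v + (cmod q)\<^sup>2 * \<tau>)"
      unfolding ab using prods' intYF v YY YF FY by (simp add: complex_norm_square[symmetric])
    \<comment> \<open>The square w^2 has mean 0 by circular symmetry, so the variance of Re w is
      half of E|w|^2; this produces the denominator 4 in the characteristic function.\<close>
    have rw: "(Re w)\<^sup>2 = Re ((w * w + w * cnj w) / 2)" for w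
      by (simp add: power2_eq_square)
    have "integrable M (\<lambda>s. (?w s * ?w s + ?w s * cnj (?w s)) / 2)"
      using Bochner_Integration.integrable_add[OF i2 i3] by (rule integrable_divide)
    from Bochner_Integration.integral_Re[OF this]
    have "expectation (\<lambda>s. (Re (?w s))\<^sup>2) = Re (expectation (\<lambda>s. (?w s * ?w s + ?w s * cnj (?w s)) / 2))"
      by (simp only: rw)
    also have "expectation (\<lambda>s. (?w s * ?w s + ?w s * cnj (?w s)) / 2) = of_real (((cmod p)\<^sup>2 * v + (cmod q)\<^sup>2 * \<tau>) / 2)"
      using i2 i3 e2 e3 by simp
    finally show "expectation (\<lambda>s. (Re (?w s))\<^sup>2) = ((cmod p)\<^sup>2 * v + (cmod q)\<^sup>2 * \<tau>) / 2" by simp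
  qed
  have norm_sq: "integrable M (\<lambda>s. (cmod (Y s))\<^sup>2)" "expectation (\<lambda>s. (cmod (Y s))\<^sup>2) = \<tau>"
  proof -
    have *: "(cmod (Y s))\<^sup>2 = Re (Y s * cnj (Y s))" for s
      by (simp add: complex_norm_square[symmetric])
    show "integrable M (\<lambda>s. (cmod (Y s))\<^sup>2)" unfolding * using intYF(3) by (rule integrable_Re)
    show "expectation (\<lambda>s. (cmod (Y s))\<^sup>2) = \<tau>" unfolding * by (subst integral_Re[OF intYF(3)]) (simp only: YY Re_complex_of_real)
  qed
  have \<tau>0: "\<tau> \<ge> 0" unfolding norm_sq(2)[symmetric] by simp
  note m4 = gaussian_rv_moment4_integrable[OF gauss mean] gaussian_rv_moment4[OF gauss mean]
  have re: "integrable M (\<lambda>s. (Re (Y s)) ^ 4)" "expectation (\<lambda>s. (Re (Y s)) ^ 4) = 3 * (\<tau> / 2)\<^sup>2"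
    using m4[of 0 1, unfolded var] by simp_all
  have im: "integrable M (\<lambda>s. (Im (Y s)) ^ 4)" "expectation (\<lambda>s. (Im (Y s)) ^ 4) = 3 * (\<tau> / 2)\<^sup>2"
    using m4[of 0 "- \<i>", unfolded var] by simp_all
  \<comment> \<open>Re Y and Im Y are centred Gaussian with variance \<tau> / 2 and fourth moment 3
    \<tau>^2 / 4, so this inequality gives E|Y|^4 <= 3 \<tau>^2.\<close>
  have le4: "cmod w ^ 4 \<le> 2 * ((Re w) ^ 4 + (Im w) ^ 4)" for w
  proof -
    have "cmod w ^ 4 = ((Re w)\<^sup>2 + (Im w)\<^sup>2)\<^sup>2" unfolding cmod_power2[symmetric] by (simp flip: power_mult)
    also have "\<dots> \<le> 2 * (((Re w)\<^sup>2)\<^sup>2 + ((Im w)\<^sup>2)\<^sup>2)"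
      using sum_squares_bound[of "(Re w)\<^sup>2" "(Im w)\<^sup>2"] by (simp add: power2_sum)
    finally show ?thesis by (simp flip: power_mult)
  qed
  have int4: "integrable M (\<lambda>s. 2 * ((Re (Y s)) ^ 4 + (Im (Y s)) ^ 4))" using re im by simp
  have Y4: "integrable M (\<lambda>s. cmod (Y s) ^ 4)"
    by (rule Bochner_Integration.integrable_bound[OF int4]) (use le4 in auto)
  have "expectation (\<lambda>s. cmod (Y s) ^ 4) \<le> expectation (\<lambda>s. 2 * ((Re (Y s)) ^ 4 + (Im (Y s)) ^ 4))"
    using Y4 int4 le4 by (rule integral_mono)
  also have "\<dots> = 3 * \<tau>\<^sup>2" using re im by (simp add: power_divide)
  finally have Y4le: "expectation (\<lambda>s. cmod (Y s) ^ 4) \<le> 3 * \<tau>\<^sup>2" .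
  have e: "- (A / 2) / 2 = - A / 4" for A :: real by simp
  show ?thesis
    unfolding Y_def[symmetric]
  proof unfold_locales
    show "expectation (\<lambda>s. iexp (Re (p * Z 0 s + q * Y s)))
       = of_real (exp (- ((cmod p)\<^sup>2 * v + (cmod q)\<^sup>2 * \<tau>) / 4))" for p q
      using gaussian_rv_char[OF gauss mean, of p q] unfolding var e .
  qed (use \<open>v > 0\<close> \<tau>0 L2[of 0] norm_sq Y4 Y4le in auto)
qed

section \<open>Noise with Gaussian power spectral density\<close>

lemma cnj_coherent: "cnj (coherent k (cnj z) t) = coherent k z t"
  by (simp add: coherent_def exp_cnj)

text \<open>Completing the square in the frequency: the exponent is 2 pi (x^2 - (y + \<xi>)^2) - b
  \<xi>^2 for z = x + iy. All covariances thereby become moments of a single normal law in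
  \<xi>.\<close>

lemma norm_fourier_coherent_weight:
  fixes b \<xi> :: real and z :: complex
  assumes b: "b > 0"
  defines "m \<equiv> - 2 * pi * Im z / (2 * pi + b)" and "\<sigma> \<equiv> 1 / sqrt (2 * (2 * pi + b))"
  shows "exp (of_real pi * (cnj z - \<i> * of_real \<xi>)\<^sup>2) * cnj (exp (of_real pi * (cnj z - \<i> * of_real \<xi>)\<^sup>2)) * of_real (exp (- b * \<xi>\<^sup>2)) =
    of_real (exp (2 * pi * (Re z)\<^sup>2 - 2 * pi * b / (2 * pi + b) * (Im z)\<^sup>2) * sqrt (pi / (2 * pi + b)) * normal_density m \<sigma> \<xi>)"
proof -
  have pos: "2 * pi + b > 0" using b by (simp add: add_pos_pos)
  have \<sigma>2: "\<sigma>\<^sup>2 = 1 / (2 * (2 * pi + b))" using pos by (simp add: \<sigma>_def power_divide)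
  have "sqrt (pi / (2 * pi + b)) * normal_density m \<sigma> \<xi> = exp (- (2 * pi + b) * (\<xi> - m)\<^sup>2)"
  proof -
    have "normal_density m \<sigma> \<xi> = 1 / sqrt (pi / (2 * pi + b)) * exp (- (2 * pi + b) * (\<xi> - m)\<^sup>2)"
    proof -
      have e: "2 * pi * (1 / (2 * c)) = pi / c" "- x\<^sup>2 / (2 * (1 / (2 * c))) = - c * x\<^sup>2" for c x :: real
        by simp_all
      show ?thesis unfolding normal_density_def \<sigma>2 e ..
    qed
    then show ?thesis using pos by simp
  qed
  then have "exp (2 * pi * (Re z)\<^sup>2 - 2 * pi * b / (2 * pi + b) * (Im z)\<^sup>2) * sqrt (pi / (2 * pi + b)) * normal_density m \<sigma> \<xi>
     = exp (2 * pi * (Re z)\<^sup>2 - 2 * pi * b / (2 * pi + b) * (Im z)\<^sup>2 + - (2 * pi + b) * (\<xi> - m)\<^sup>2)"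
    by (simp only: mult.assoc exp_add)
  also have "2 * pi * (Re z)\<^sup>2 - 2 * pi * b / (2 * pi + b) * (Im z)\<^sup>2 + - (2 * pi + b) * (\<xi> - m)\<^sup>2 =
     2 * pi * ((Re z)\<^sup>2 - (Im z + \<xi>)\<^sup>2) - b * \<xi>\<^sup>2"
  proof -
    have m: "(2 * pi + b) * m = - 2 * pi * Im z" using pos by (simp add: m_def)
    have "(2 * pi + b) * (\<xi> - m)\<^sup>2 = (2 * pi + b) * \<xi>\<^sup>2 - 2 * ((2 * pi + b) * m) * \<xi> + ((2 * pi + b) * m) * m"
      by (simp add: power2_eq_square algebra_simps)
    also have "\<dots> = (2 * pi + b) * \<xi>\<^sup>2 + 4 * pi * Im z * \<xi> + 4 * pi\<^sup>2 * (Im z)\<^sup>2 / (2 * pi + b)"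
      unfolding m by (simp add: m_def power2_eq_square)
    finally have 1: "(2 * pi + b) * (\<xi> - m)\<^sup>2 = (2 * pi + b) * \<xi>\<^sup>2 + 4 * pi * Im z * \<xi> + 4 * pi\<^sup>2 * (Im z)\<^sup>2 / (2 * pi + b)" .
    have 2: "2 * pi * b / (2 * pi + b) * (Im z)\<^sup>2 = 2 * pi * (Im z)\<^sup>2 - 4 * pi\<^sup>2 * (Im z)\<^sup>2 / (2 * pi + b)"
      using pos by (simp add: field_simps power2_eq_square)
    show ?thesis unfolding mult_minus_left 1 2 by (simp add: power2_eq_square algebra_simps)
  qed
  also have "of_real (exp (2 * pi * ((Re z)\<^sup>2 - (Im z + \<xi>)\<^sup>2) - b * \<xi>\<^sup>2)) =
     exp (of_real pi * (cnj z - \<i> * of_real \<xi>)\<^sup>2) * cnj (exp (of_real pi * (cnj z - \<i> * of_real \<xi>)\<^sup>2)) * of_real (exp (- b * \<xi>\<^sup>2))"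
    unfolding exp_of_real[symmetric] exp_cnj exp_add[symmetric]
    by (rule arg_cong[of _ _ exp]) (simp add: complex_eq_iff power2_eq_square algebra_simps)
  finally show ?thesis by simp
qed

locale gauss_psd_noise = psd_noise M W "\<lambda>\<omega>. exp (- b * \<omega>\<^sup>2)" for M :: "'a measure" and W b +
  assumes b_pos: "b > 0"
begin

definition H :: "nat \<Rightarrow> complex \<Rightarrow> 'a \<Rightarrow> complex" where
  "H k z s = W (coherent k z) s"

text \<open>This is E|H 0 z|^2; see \<open>H_00\<close>.\<close>

definition var :: "complex \<Rightarrow> real" where
  "var z = exp (2 * pi * (Re z)\<^sup>2 - 2 * pi * b / (2 * pi + b) * (Im z)\<^sup>2) * sqrt (pi / (2 * pi + b))"

text \<open>The factor by which coloured noise contracts the imaginary part in \<open>drift\<close>;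
  1 - \<beta> is the intensity to be found.\<close>

definition \<beta> :: real where "\<beta> = b / (2 * pi + b)"

text \<open>The regression coefficient of \<open>H 1 z\<close> on \<open>H 0 z\<close>, that is h(z)
  / (2 pi), because F' = 2 pi H 1.\<close>

definition drift :: "complex \<Rightarrow> complex" where
  "drift z = Complex (Re z) (\<beta> * Im z)"

lemma denom_pos: "2 * pi + b > 0"
  using b_pos by (simp add: add_pos_pos)

lemma var_pos: "var z > 0"
  using denom_pos by (simp add: var_def)

lemma H_measurable [measurable]: "H k z \<in> borel_measurable M"
  unfolding H_def[abs_def] by (rule rv[OF schwartz_coherent])

lemma H_L2: "integrable M (\<lambda>s. (cmod (H k z s))\<^sup>2)"
  unfolding H_def by (rule square_integrable[OF schwartz_coherent])

text \<open>The pairing conjugates its test function, hence \<open>cnj z\<close> on the right; the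
  indices k and l change places as in the covariance axiom.\<close>

lemma H_covariance:
  "expectation (\<lambda>s. H k z s * cnj (H l z s)) =
    (LINT \<xi>|lborel. fourier (coherent l (cnj z)) \<xi> * cnj (fourier (coherent k (cnj z)) \<xi>) * of_real (exp (- b * \<xi>\<^sup>2)))"
  using covariance[OF schwartz_coherent[of k "cnj z"] schwartz_coherent[of l "cnj z"]]
  by (simp add: H_def pairing_def cnj_coherent)

text \<open>Mean, and with \<open>sd\<close> below the standard deviation, of the normal law in
  frequency found by completing the square.\<close>

definition mid :: "complex \<Rightarrow> real" where "mid z = - 2 * pi * Im z / (2 * pi + b)"

definition sd :: real where "sd = 1 / sqrt (2 * (2 * pi + b))"

lemma sd_pos: "sd > 0" using denom_pos by (simp add: sd_def)

lemma drift_eq: "drift z = Complex (Re z) (Im z + mid z)"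
  using denom_pos by (simp add: drift_def \<beta>_def mid_def field_simps)

lemma weight: "exp (of_real pi * (cnj z - \<i> * of_real \<xi>)\<^sup>2) * cnj (exp (of_real pi * (cnj z - \<i> * of_real \<xi>)\<^sup>2)) * of_real (exp (- b * \<xi>\<^sup>2)) =
    of_real (var z * normal_density (mid z) sd \<xi>)"
  using norm_fourier_coherent_weight[OF b_pos, of z \<xi>] unfolding var_def mid_def sd_def .

lemma H_00: "expectation (\<lambda>s. H 0 z s * cnj (H 0 z s)) = of_real (var z)"
  unfolding H_covariance fourier_coherent_0 weight integral_complex_of_real using sd_pos by simp

text \<open>The extra factor in the Fourier transform is conjugated to z + i \<xi>, whose mean under
  the normal law is z + i \<open>mid z\<close>.\<close>

lemma H_10: "expectation (\<lambda>s. H 1 z s * cnj (H 0 z s)) = drift z * of_real (var z)"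
proof -
  have nd: "integrable lborel (normal_density (mid z) sd)" "integrable lborel (\<lambda>\<xi>. normal_density (mid z) sd \<xi> * \<xi>)"
    "(LINT \<xi>|lborel. normal_density (mid z) sd \<xi>) = 1" "(LINT \<xi>|lborel. normal_density (mid z) sd \<xi> * \<xi>) = mid z"
    using sd_pos integrable_normal_moment_nz_1 integral_normal_moment_nz_1 by auto
  let ?n = "\<lambda>\<xi>. complex_of_real (normal_density (mid z) sd \<xi>)"
  have "exp (of_real pi * (cnj z - \<i> * of_real \<xi>)\<^sup>2) * cnj ((cnj z - \<i> * of_real \<xi>) * exp (of_real pi * (cnj z - \<i> * of_real \<xi>)\<^sup>2)) * of_real (exp (- b * \<xi>\<^sup>2)) =
     of_real (var z) * (z * ?n \<xi> + \<i> * of_real (normal_density (mid z) sd \<xi> * \<xi>))" (is "?E * cnj (?c * ?E) * ?B = _") for \<xi>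
  proof -
    have "?E * cnj (?c * ?E) * ?B = cnj ?c * (?E * cnj ?E * ?B)" by (simp add: mult_ac)
    also have "\<dots> = of_real (var z) * (z * ?n \<xi> + \<i> * of_real (normal_density (mid z) sd \<xi> * \<xi>))"
      unfolding weight by (simp add: algebra_simps)
    finally show ?thesis .
  qed
  then have "expectation (\<lambda>s. H 1 z s * cnj (H 0 z s)) =
     (LINT \<xi>|lborel. of_real (var z) * (z * ?n \<xi> + \<i> * of_real (normal_density (mid z) sd \<xi> * \<xi>)))"
    unfolding H_covariance fourier_coherent_0 fourier_coherent_1 by simp
  also have "\<dots> = of_real (var z) * (z * (LINT \<xi>|lborel. ?n \<xi>) + \<i> * (LINT \<xi>|lborel. of_real (normal_density (mid z) sd \<xi> * \<xi>)))"
    using nd(1,2) by (subst integral_mult_right_zero, subst Bochner_Integration.integral_add) (auto simp del: of_real_mult)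
  also have "\<dots> = of_real (var z) * (z + \<i> * of_real (mid z))"
    unfolding integral_complex_of_real nd by simp
  also have "z + \<i> * of_real (mid z) = drift z" by (simp add: drift_eq complex_eq_iff)
  finally show ?thesis by (simp add: mult.commute)
qed

lemma H_11: "expectation (\<lambda>s. H 1 z s * cnj (H 1 z s)) = of_real (var z * sd\<^sup>2 + (cmod (drift z))\<^sup>2 * var z)"
proof -
  let ?n = "normal_density (mid z) sd"
  have nd: "integrable lborel ?n" "integrable lborel (\<lambda>\<xi>. ?n \<xi> * (\<xi> - mid z))" "integrable lborel (\<lambda>\<xi>. ?n \<xi> * (\<xi> - mid z)\<^sup>2)"
    using integrable_normal_moment[OF sd_pos, of "mid z" 1] integrable_normal_moment[OF sd_pos, of "mid z" 2] sd_pos by auto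
  have nd': "(LINT \<xi>|lborel. ?n \<xi>) = 1" "(LINT \<xi>|lborel. ?n \<xi> * (\<xi> - mid z)) = 0" "(LINT \<xi>|lborel. ?n \<xi> * (\<xi> - mid z)\<^sup>2) = sd\<^sup>2"
    using integral_normal_moment_odd[OF sd_pos, of "mid z" 0] integral_normal_moment_even[OF sd_pos, of "mid z" 1] sd_pos
    by (auto simp: eval_nat_numeral)
  have norm2: "(cmod (drift z))\<^sup>2 = (Re z)\<^sup>2 + (Im z + mid z)\<^sup>2"
    by (simp add: drift_eq cmod_power2)
  have "((cnj z - \<i> * of_real \<xi>) * exp (of_real pi * (cnj z - \<i> * of_real \<xi>)\<^sup>2)) *
      cnj ((cnj z - \<i> * of_real \<xi>) * exp (of_real pi * (cnj z - \<i> * of_real \<xi>)\<^sup>2)) * of_real (exp (- b * \<xi>\<^sup>2)) =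
     of_real (var z * ((cmod (drift z))\<^sup>2 * ?n \<xi> + 2 * (Im z + mid z) * (?n \<xi> * (\<xi> - mid z)) + ?n \<xi> * (\<xi> - mid z)\<^sup>2))"
    (is "(?c * ?E) * cnj (?c * ?E) * ?B = _") for \<xi>
  proof -
    have "(?c * ?E) * cnj (?c * ?E) * ?B = (?c * cnj ?c) * (?E * cnj ?E * ?B)" by (simp add: mult_ac)
    \<comment> \<open>Expanding about the mean frequency kills the linear term and isolates the
      variance sd^2 as the part that regression leaves unexplained.\<close>
    also have "?c * cnj ?c = of_real ((cmod (drift z))\<^sup>2 + 2 * (Im z + mid z) * (\<xi> - mid z) + (\<xi> - mid z)\<^sup>2)"
      unfolding norm2 by (simp add: complex_eq_iff power2_eq_square algebra_simps)
    finally show ?thesis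
      unfolding weight of_real_mult[symmetric] by (simp add: algebra_simps del: of_real_mult of_real_add)
  qed
  then have "expectation (\<lambda>s. H 1 z s * cnj (H 1 z s)) = of_real
     (LINT \<xi>|lborel. var z * ((cmod (drift z))\<^sup>2 * ?n \<xi> + 2 * (Im z + mid z) * (?n \<xi> * (\<xi> - mid z)) + ?n \<xi> * (\<xi> - mid z)\<^sup>2))"
    unfolding H_covariance fourier_coherent_1 by (simp only: integral_complex_of_real)
  also have "(LINT \<xi>|lborel. var z * ((cmod (drift z))\<^sup>2 * ?n \<xi> + 2 * (Im z + mid z) * (?n \<xi> * (\<xi> - mid z)) + ?n \<xi> * (\<xi> - mid z)\<^sup>2))
     = var z * ((cmod (drift z))\<^sup>2 * 1 + 2 * (Im z + mid z) * 0 + sd\<^sup>2)"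
    unfolding nd'[symmetric] using nd by simp
  finally show ?thesis by (simp add: algebra_simps)
qed

lemma circ_gauss_pair_H: "circ_gauss_pair M (H 0 z) (\<lambda>s. H 1 z s - drift z * H 0 z s) (var z) (var z * sd\<^sup>2)"
proof (rule circ_gauss_pairI)
  show "circ_sym_gaussian M 2 (\<lambda>k. H k z)"
    unfolding H_def[abs_def] by (rule gaussian[OF schwartz_coherent])
qed (use H_L2 H_00 H_10 H_11 var_pos in auto)

end

section \<open>The argument principle on rectangles\<close>

lemma entire_factor_root:
  assumes f: "f holomorphic_on UNIV" and z0: "f z0 = 0"
  obtains g where "g holomorphic_on UNIV" "g z0 = deriv f z0" "\<And>w. f w = (w - z0) * g w"
proof -
  let ?g = "\<lambda>z. if z = z0 then deriv f z0 else (f z - f z0) / (z - z0)"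
  have "?g holomorphic_on UNIV" using f by (intro pole_lemma_open) auto
  moreover have "f w = (w - z0) * ?g w" for w using z0 by auto
  ultimately show ?thesis by (intro that[of ?g]) auto
qed

text \<open>The constant is a natural number because it depends on the sample: the almost sure
  statement it is compared with holds for all natural m at once.\<close>

lemma entire_root_bound:
  assumes f: "f holomorphic_on UNIV" and z0: "f z0 = 0" and K: "compact K"
  obtains m :: nat where "\<And>w. w \<in> K \<Longrightarrow> cmod (f w) \<le> real m * cmod (w - z0)"
proof -
  obtain g where g: "g holomorphic_on UNIV" "\<And>w. f w = (w - z0) * g w"
    using entire_factor_root[OF f z0] by blast
  have "continuous_on K g" using g(1) holomorphic_on_imp_continuous_on continuous_on_subset by blast
  then have "bounded (g ` K)" using K compact_continuous_image compact_imp_bounded by blast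
  then obtain B where B: "\<And>w. w \<in> K \<Longrightarrow> cmod (g w) \<le> B" by (auto simp: bounded_iff)
  obtain m :: nat where m: "B \<le> real m" using real_arch_simple by blast
  have "cmod (f w) \<le> real m * cmod (w - z0)" if "w \<in> K" for w
    using order_trans[OF B[OF that] m] unfolding g(2) norm_mult by (subst mult.commute) (intro mult_right_mono, auto)
  then show ?thesis using that by blast
qed

lemma entire_double_root_bound:
  assumes f: "f holomorphic_on UNIV" and z0: "f z0 = 0" "deriv f z0 = 0" and K: "compact K"
  obtains m :: nat where "\<And>w. w \<in> K \<Longrightarrow> cmod (f w) \<le> real m * (cmod (w - z0))\<^sup>2"
proof -
  obtain g where g: "g holomorphic_on UNIV" "g z0 = 0" "\<And>w. f w = (w - z0) * g w"
    using entire_factor_root[OF f z0(1)] z0(2) by metis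
  obtain m :: nat where m: "\<And>w. w \<in> K \<Longrightarrow> cmod (g w) \<le> real m * cmod (w - z0)"
    using entire_root_bound[OF g(1,2) K] by blast
  have "cmod (f w) \<le> real m * (cmod (w - z0))\<^sup>2" if "w \<in> K" for w
    using mult_left_mono[OF m[OF that], of "cmod (w - z0)"]
    unfolding g(3) norm_mult by (simp add: power2_eq_square mult_ac)
  then show ?thesis using that by blast
qed

lemma contour_integral_rectpath_logderiv:
  assumes f: "f holomorphic_on UNIV"
    and ab: "Re a < Re b" "Im a < Im b"
    and bdry: "\<And>z. z \<in> path_image (rectpath a b) \<Longrightarrow> f z \<noteq> 0"
    and simple: "\<And>z. f z = 0 \<Longrightarrow> deriv f z \<noteq> 0"
  shows "finite {z \<in> box a b. f z = 0}"
    and "contour_integral (rectpath a b) (\<lambda>z. deriv f z / f z) = 2 * pi * \<i> * of_nat (card {z \<in> box a b. f z = 0})"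
proof -
  \<comment> \<open>The open domain for the argument principle: the rectangle enlarged by 1. It is
    bounded, hence contains finitely many zeros, and those outside the rectangle have winding number
    0.\<close>
  define S where "S = box (a - Complex 1 1) (b + Complex 1 1)"
  have S: "open S" "connected S" "cbox a b \<subseteq> S"
    using ab by (auto simp: S_def convex_connected in_box_complex_iff in_cbox_complex_iff convex_box)
  \<comment> \<open>The finiteness of zeros in compact sets is for nonconstant functions; a constant
    f has no zero because the corner a lies on the path.\<close>
  have fin: "finite {w \<in> T. f w = 0}" if T: "bounded T" for T
  proof (cases "f constant_on UNIV")
    case True
    have "f a \<noteq> 0" using bdry[of a] pathstart_in_path_image[of "rectpath a b"] by simp
    then have "f w \<noteq> 0" for w using True unfolding constant_on_def by (metis UNIV_I)
    then show ?thesis by simp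
  next
    case False
    have "finite {w \<in> closure T. f w = 0}"
      using T False by (intro holomorphic_compact_finite_zeros[OF f]) auto
    then show ?thesis by (rule finite_subset[rotated]) (use closure_subset in auto)
  qed
  have bS: "bounded S" by (simp add: S_def bounded_box)
  show finbox: "finite {z \<in> box a b. f z = 0}" by (rule fin) (rule bounded_box)
  have img: "path_image (rectpath a b) \<subseteq> cbox a b" using ab by (intro path_image_rectpath_subset_cbox) auto
  have "contour_integral (rectpath a b) (\<lambda>x. deriv f x * 1 / f x) = 2 * pi * \<i> *
      (\<Sum>p\<in>{w \<in> S. f w = 0 \<or> w \<in> {}}. winding_number (rectpath a b) p * 1 * zorder f p)"
  proof (rule argument_principle)
    show "f holomorphic_on S - {}" using f by (rule holomorphic_on_subset) auto
    show "path_image (rectpath a b) \<subseteq> S - {w \<in> S. f w = 0 \<or> w \<in> {}}"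
      using img S(3) bdry by blast
    show "\<forall>z. z \<notin> S \<longrightarrow> winding_number (rectpath a b) z = 0"
    proof (intro allI impI)
      fix z assume "z \<notin> S"
      then have "z \<notin> cbox a b" using S(3) by blast
      then show "winding_number (rectpath a b) z = 0"
        using ab by (intro winding_number_rectpath_outside) auto
    qed
    show "finite {w \<in> S. f w = 0 \<or> w \<in> {}}" using fin[OF bS] by simp
  qed (use S in auto)
  also have "(\<Sum>p\<in>{w \<in> S. f w = 0 \<or> w \<in> {}}. winding_number (rectpath a b) p * 1 * zorder f p) =
      (\<Sum>p\<in>{z \<in> box a b. f z = 0}. 1)"
  proof (rule sum.mono_neutral_cong_right)
    show "finite {w \<in> S. f w = 0 \<or> w \<in> {}}" using fin[OF bS] by simp
    show "{z \<in> box a b. f z = 0} \<subseteq> {w \<in> S. f w = 0 \<or> w \<in> {}}" using S(3) box_subset_cbox by blast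
    show "\<forall>i\<in>{w \<in> S. f w = 0 \<or> w \<in> {}} - {z \<in> box a b. f z = 0}. winding_number (rectpath a b) i * 1 * zorder f i = 0"
    proof
      fix z assume z: "z \<in> {w \<in> S. f w = 0 \<or> w \<in> {}} - {z \<in> box a b. f z = 0}"
      then have "z \<notin> path_image (rectpath a b)" "z \<notin> box a b" using bdry by auto
      then have "z \<notin> cbox a b" using ab by (simp add: path_image_rectpath_cbox_minus_box)
      then have "winding_number (rectpath a b) z = 0"
        using ab by (intro winding_number_rectpath_outside) auto
      then show "winding_number (rectpath a b) z * 1 * zorder f z = 0" by simp
    qed
    fix z assume z: "z \<in> {z \<in> box a b. f z = 0}"
    have "zorder f z = 1"
      by (rule zorder_zero_eqI[OF f open_UNIV UNIV_I]) (use z simple[of z] in auto)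
    moreover have "winding_number (rectpath a b) z = 1"
      using z by (intro winding_number_rectpath) auto
    ultimately show "winding_number (rectpath a b) z * 1 * zorder f z = 1" by simp
  qed
  finally show "contour_integral (rectpath a b) (\<lambda>z. deriv f z / f z) = 2 * pi * \<i> * of_nat (card {z \<in> box a b. f z = 0})"
    by simp
qed

text \<open>The contour integral over a segment as a Lebesgue integral, defined for arbitrary
  integrands, so that Fubini applies to random ones.\<close>

definition line_integral :: "complex \<Rightarrow> complex \<Rightarrow> (complex \<Rightarrow> complex) \<Rightarrow> complex" where
  "line_integral p q \<phi> = (LINT t|lborel. indicator {0..1} t *\<^sub>R (\<phi> (linepath p q t) * (q - p)))"

definition rect_integral :: "complex \<Rightarrow> complex \<Rightarrow> (complex \<Rightarrow> complex) \<Rightarrow> complex" where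
  "rect_integral a b \<phi> = line_integral a (Complex (Re b) (Im a)) \<phi> + line_integral (Complex (Re b) (Im a)) b \<phi>
     + line_integral b (Complex (Re a) (Im b)) \<phi> + line_integral (Complex (Re a) (Im b)) a \<phi>"

lemma contour_integral_linepath_eq_line_integral:
  assumes "continuous_on (closed_segment p q) \<phi>"
  shows "contour_integral (linepath p q) \<phi> = line_integral p q \<phi>"
proof -
  have c: "continuous_on {0..1} (\<lambda>t. \<phi> (linepath p q t) * (q - p))"
    using assms by (intro continuous_intros continuous_on_compose2[OF assms]) (auto simp: linepath_in_path)
  have "set_integrable lborel {0..1} (\<lambda>t. \<phi> (linepath p q t) * (q - p))"
    unfolding set_integrable_def using c by (intro borel_integrable_compact) auto
  from set_borel_integral_eq_integral(2)[OF this]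
  show ?thesis
    unfolding contour_integral_integral line_integral_def set_lebesgue_integral_def
    by (simp only: vector_derivative_linepath_at)
qed

lemma contour_integral_rectpath_eq_rect_integral:
  assumes c: "continuous_on (path_image (rectpath a b)) \<phi>"
  shows "contour_integral (rectpath a b) \<phi> = rect_integral a b \<phi>"
proof -
  have c': "continuous_on (closed_segment a (Complex (Re b) (Im a))) \<phi>" "continuous_on (closed_segment (Complex (Re b) (Im a)) b) \<phi>"
    "continuous_on (closed_segment b (Complex (Re a) (Im b))) \<phi>" "continuous_on (closed_segment (Complex (Re a) (Im b)) a) \<phi>"
    by (rule continuous_on_subset[OF c]; auto simp: rectpath_def Let_def path_image_join)+
  show ?thesis
    unfolding rectpath_def Let_def rect_integral_def
    using c' by (simp add: contour_integrable_continuous_linepath contour_integral_linepath_eq_line_integral add.assoc)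
qed

text \<open>A real-linear integrand contributes its value at the midpoint. It need not be
  holomorphic, so the primitive F is taken in the parameter t of the segment.\<close>

lemma line_integral_affine:
  "line_integral p q (\<lambda>z. Complex (Re z) (\<beta> * Im z)) = (q - p) * Complex (Re (p + q) / 2) (\<beta> * Im (p + q) / 2)"
proof -
  let ?\<phi> = "\<lambda>z. Complex (Re z) (\<beta> * Im z)"
  have "continuous_on (closed_segment p q) ?\<phi>"
    unfolding Complex_eq by (intro continuous_intros)
  then have "line_integral p q ?\<phi> = contour_integral (linepath p q) ?\<phi>"
    by (rule contour_integral_linepath_eq_line_integral[symmetric])
  also have "\<dots> = (q - p) * Complex (Re (p + q) / 2) (\<beta> * Im (p + q) / 2)"
  proof (rule contour_integral_unique, unfold has_contour_integral_linepath)
    define F where "F t = (q - p) * (of_real t * ?\<phi> p + of_real (t\<^sup>2 / 2) * ?\<phi> (q - p))" for t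
    have "((\<lambda>t. ?\<phi> (linepath p q t) * (q - p)) has_integral F 1 - F 0) {0..1}"
    proof (rule fundamental_theorem_of_calculus)
      fix t :: real
      have "(F has_vector_derivative (q - p) * (1 * ?\<phi> p + of_real t * ?\<phi> (q - p))) (at t within {0..1})"
      proof -
        have "((\<lambda>w. (q - p) * (w * ?\<phi> p + w\<^sup>2 / 2 * ?\<phi> (q - p))) has_field_derivative
            (q - p) * (1 * ?\<phi> p + of_real t * ?\<phi> (q - p))) (at (of_real t))"
          by (auto intro!: derivative_eq_intros)
        from has_vector_derivative_real_field[OF this]
        show ?thesis unfolding F_def by (simp add: has_vector_derivative_at_within)
      qed
      moreover have "(q - p) * (1 * ?\<phi> p + of_real t * ?\<phi> (q - p)) = ?\<phi> (linepath p q t) * (q - p)"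
        by (simp add: linepath_def complex_eq_iff algebra_simps)
      ultimately show "(F has_vector_derivative ?\<phi> (linepath p q t) * (q - p)) (at t within {0..1})" by (simp only:)
    qed simp
    moreover have "F 1 - F 0 = (q - p) * Complex (Re (p + q) / 2) (\<beta> * Im (p + q) / 2)"
      by (simp add: F_def complex_eq_iff field_simps)
    ultimately show "((\<lambda>t. ?\<phi> (linepath p q t) * (q - p)) has_integral (q - p) * Complex (Re (p + q) / 2) (\<beta> * Im (p + q) / 2)) {0..1}"
      by simp
  qed
  finally show ?thesis .
qed

text \<open>Green's formula for a constant d-bar derivative (1 - \<beta>) / 2, obtained here by
  adding the four midpoint values.\<close>

lemma rect_integral_affine:
  "rect_integral a b (\<lambda>z. Complex (Re z) (\<beta> * Im z)) = \<i> * of_real ((1 - \<beta>) * (Re b - Re a) * (Im b - Im a))"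
  unfolding rect_integral_def line_integral_affine by (simp add: complex_eq_iff field_simps)

section \<open>Zeros are simple and avoid segments\<close>

context gauss_psd_noise
begin

lemma prob_H_le: "\<delta> > 0 \<Longrightarrow> prob {s \<in> space M. cmod (H 0 z s) \<le> \<delta>} \<le> 3 * \<delta>\<^sup>2 / var z"
  by (rule circ_gauss_pair.prob_norm_le[OF circ_gauss_pair_H])

lemma var_continuous: "continuous_on A var"
  unfolding var_def[abs_def] by (intro continuous_intros)

text \<open>Bulinskaya's argument: a zero forces smallness at a nearby grid point, which is too unlikely for the
  given number of grid points.\<close>

lemma AE_not_small_on_grids:
  fixes C :: "nat \<Rightarrow> complex set" and \<delta> :: "nat \<Rightarrow> real"
  assumes K: "compact K" and C: "\<And>n. C n \<subseteq> K" "\<And>n. finite (C n)" and \<delta>: "\<And>n. \<delta> n > 0"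
    and lim: "(\<lambda>n. real (card (C n)) * (\<delta> n)\<^sup>2) \<longlonglongrightarrow> 0"
  shows "AE s in M. \<forall>m::nat. \<exists>n. \<forall>c\<in>C n. cmod (H 0 c s) > real m * \<delta> n"
proof (unfold AE_all_countable, intro allI)
  fix m :: nat
  obtain B where B: "B > 0" "\<And>z. z \<in> K \<Longrightarrow> 3 / var z \<le> B"
  proof -
    have "continuous_on K (\<lambda>z. 3 / var z)"
      using var_pos by (intro continuous_intros var_continuous) (auto simp: less_imp_neq[symmetric])
    then have "bounded ((\<lambda>z. 3 / var z) ` K)" using K compact_continuous_image compact_imp_bounded by blast
    then show ?thesis using that unfolding bounded_pos by (auto simp: abs_le_iff)
  qed
  \<comment> \<open>With m + 1 in place of m the threshold is positive even for m = 0, as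
    \<open>prob_H_le\<close> requires.\<close>
  define E where "E n = (\<Union>c\<in>C n. {s \<in> space M. cmod (H 0 c s) \<le> (real m + 1) * \<delta> n})" for n
  have [measurable]: "E n \<in> sets M" for n
    unfolding E_def using C(2) by (intro sets.finite_UN) auto
  have pE: "prob (E n) \<le> B * (real m + 1)\<^sup>2 * (real (card (C n)) * (\<delta> n)\<^sup>2)" for n
  proof -
    have "prob (E n) \<le> (\<Sum>c\<in>C n. prob {s \<in> space M. cmod (H 0 c s) \<le> (real m + 1) * \<delta> n})"
      unfolding E_def by (intro finite_measure_subadditive_finite C) auto
    also have "\<dots> \<le> (\<Sum>c\<in>C n. B * ((real m + 1) * \<delta> n)\<^sup>2)"
    proof (rule sum_mono)
      fix c assume "c \<in> C n"
      have "prob {s \<in> space M. cmod (H 0 c s) \<le> (real m + 1) * \<delta> n} \<le> 3 / var c * ((real m + 1) * \<delta> n)\<^sup>2"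
        using prob_H_le[of "(real m + 1) * \<delta> n" c] \<delta>[of n] by (simp add: add_nonneg_pos)
      also have "\<dots> \<le> B * ((real m + 1) * \<delta> n)\<^sup>2"
        using \<open>c \<in> C n\<close> C(1) by (intro mult_right_mono B(2)) auto
      finally show "prob {s \<in> space M. cmod (H 0 c s) \<le> (real m + 1) * \<delta> n} \<le> B * ((real m + 1) * \<delta> n)\<^sup>2" .
    qed
    finally show ?thesis by (simp add: power_mult_distrib mult_ac)
  qed
  have "(\<lambda>n. B * (real m + 1)\<^sup>2 * (real (card (C n)) * (\<delta> n)\<^sup>2)) \<longlonglongrightarrow> B * (real m + 1)\<^sup>2 * 0"
    by (intro tendsto_mult tendsto_const lim)
  \<comment> \<open>It suffices that a single grid succeeds, so only the intersection of the bad
    events matters; its probability is below every bound, and these tend to 0.\<close>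
  moreover have "prob (\<Inter>n. E n) \<le> B * (real m + 1)\<^sup>2 * (real (card (C n)) * (\<delta> n)\<^sup>2)" for n
    by (rule order_trans[OF finite_measure_mono pE]) auto
  ultimately have "prob (\<Inter>n. E n) \<le> 0"
    by (intro LIMSEQ_le_const[of _ "0::real"]) auto
  then have "prob (\<Inter>n. E n) = 0" using measure_nonneg by (rule antisym)
  then have "(\<Inter>n. E n) \<in> null_sets M" by (auto simp: null_sets_def emeasure_eq_measure)
  then show "AE s in M. \<exists>n. \<forall>c\<in>C n. cmod (H 0 c s) > real m * \<delta> n"
  proof (rule AE_I')
    show "{s \<in> space M. \<not> (\<exists>n. \<forall>c\<in>C n. cmod (H 0 c s) > real m * \<delta> n)} \<subseteq> (\<Inter>n. E n)"
    proof (intro subsetI INT_I)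
      fix s n assume s: "s \<in> {s \<in> space M. \<not> (\<exists>n. \<forall>c\<in>C n. cmod (H 0 c s) > real m * \<delta> n)}"
      then obtain c where c: "c \<in> C n" "cmod (H 0 c s) \<le> real m * \<delta> n" by (auto simp: not_less)
      have "real m * \<delta> n \<le> (real m + 1) * \<delta> n" using \<delta>[of n] by (intro mult_right_mono) auto
      with c s show "s \<in> E n" by (auto simp: E_def intro: order_trans)
    qed
  qed
qed

text \<open>On this event linearity and continuity hold for all Schwartz functions simultaneously,
  so the whole function z -> \<open>H k z s\<close> is entire.\<close>

definition good :: "'a \<Rightarrow> bool" where
  "good s \<longleftrightarrow> tempered_distribution (\<lambda>\<phi>. W \<phi> s)"

lemma AE_good: "AE s in M. good s"
  unfolding good_def by (rule realizations)

lemma good_deriv: "good s \<Longrightarrow> ((\<lambda>z. H k z s) has_field_derivative 2 * of_real pi * H (Suc k) z s) (at z)"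
  unfolding good_def H_def by (rule tempered_distribution_coherent_deriv)

lemma good_holomorphic: "good s \<Longrightarrow> (\<lambda>z. H k z s) holomorphic_on UNIV"
  using good_deriv[of s k] by (auto simp: holomorphic_on_def field_differentiable_def intro: has_field_derivative_at_within)

lemma good_deriv_eq: "good s \<Longrightarrow> deriv (\<lambda>z. H k z s) z = 2 * of_real pi * H (Suc k) z s"
  by (rule DERIV_imp_deriv[OF good_deriv])

text \<open>A zero makes |F| of order 1/n at one of n + 2 equally spaced points; each such event has
  probability O(n^-2), and the sum is O(1/n).\<close>

lemma AE_no_zero_on_segment: "AE s in M. \<forall>z\<in>closed_segment p q. H 0 z s \<noteq> 0"
proof -
  define C where "C n = (\<lambda>i. linepath p q (real i / real (Suc n))) ` {..Suc n}" for n
  have card: "card (C n) \<le> Suc (Suc n)" for n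
    unfolding C_def using card_image_le[of "{..Suc n}"] by simp
  have "AE s in M. \<forall>m::nat. \<exists>n. \<forall>c\<in>C n. cmod (H 0 c s) > real m * (1 / real (Suc n))"
  proof (rule AE_not_small_on_grids)
    show "compact (closed_segment p q)" by simp
    show "C n \<subseteq> closed_segment p q" for n
      unfolding C_def by (auto intro!: linepath_in_path simp: divide_simps)
    show "finite (C n)" for n unfolding C_def by simp
    have "(\<lambda>n. real (Suc (Suc n)) * (1 / real (Suc n))\<^sup>2) \<longlonglongrightarrow> 0" by real_asymp
    then show "(\<lambda>n. real (card (C n)) * (1 / real (Suc n))\<^sup>2) \<longlonglongrightarrow> 0"
      by (rule Lim_null_comparison[rotated]) (use card in \<open>auto intro!: always_eventually mult_right_mono simp del: of_nat_Suc\<close>)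
  qed simp
  with AE_good show ?thesis
  proof eventually_elim
    case (elim s)
    show ?case
    proof (intro ballI notI)
      fix z assume z: "z \<in> closed_segment p q" "H 0 z s = 0"
      obtain m :: nat where m: "\<And>w. w \<in> closed_segment p q \<Longrightarrow> cmod (H 0 w s) \<le> real m * cmod (w - z)"
        using entire_root_bound[OF good_holomorphic[OF elim(1)] z(2) compact_segment, of p q] by blast
      \<comment> \<open>Combines the Lipschitz constant at the zero with the length of the segment;
        the grid spacing is |q - p| / (n + 1).\<close>
      obtain M' :: nat where M': "real m * cmod (q - p) \<le> real M'" using real_arch_simple by blast
      obtain n where n: "\<And>c. c \<in> C n \<Longrightarrow> cmod (H 0 c s) > real M' * (1 / real (Suc n))" using elim(2) by blast
      obtain t where t: "0 \<le> t" "t \<le> 1" "z = linepath p q t"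
        using z(1) by (auto simp: closed_segment_def linepath_def)
      define i where "i = nat \<lfloor>t * real (Suc n)\<rfloor>"
      have i: "real i \<le> t * real (Suc n)" "t * real (Suc n) \<le> real i + 1"
        using t by (auto simp: i_def)
      have "real i \<le> real (Suc n)" using order_trans[OF i(1) mult_right_mono[OF t(2) of_nat_0_le_iff]] by (simp only: mult_1)
      then have c: "linepath p q (real i / real (Suc n)) \<in> C n" unfolding C_def by auto
      have seg: "linepath p q (real i / real (Suc n)) \<in> closed_segment p q"
        using \<open>real i \<le> real (Suc n)\<close> by (intro linepath_in_path) (auto simp: divide_simps)
      have "linepath p q (real i / real (Suc n)) - z = of_real (real i / real (Suc n) - t) * (q - p)"
      proof -
        have "linepath p q u - linepath p q t = of_real (u - t) * (q - p)" for u
          by (simp add: linepath_def scaleR_conv_of_real algebra_simps)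
        then show ?thesis unfolding t(3) .
      qed
      then have "cmod (linepath p q (real i / real (Suc n)) - z) = \<bar>real i / real (Suc n) - t\<bar> * cmod (q - p)"
        by (simp only: norm_mult norm_of_real)
      also have "\<dots> \<le> 1 / real (Suc n) * cmod (q - p)"
      proof (rule mult_right_mono)
        have "real i / real (Suc n) - t = (real i - t * real (Suc n)) / real (Suc n)"
          by (simp add: diff_divide_distrib del: of_nat_Suc)
        moreover have "\<bar>real i - t * real (Suc n)\<bar> \<le> 1" using i by linarith
        ultimately show "\<bar>real i / real (Suc n) - t\<bar> \<le> 1 / real (Suc n)"
          by (simp only: abs_divide abs_of_nat divide_right_mono of_nat_0_le_iff)
      qed simp
      finally have "real m * cmod (linepath p q (real i / real (Suc n)) - z) \<le> real m * cmod (q - p) * (1 / real (Suc n))"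
        by (metis (no_types, lifting) mult.assoc mult.commute mult_left_mono of_nat_0_le_iff)
      also have "\<dots> \<le> real M' * (1 / real (Suc n))" by (intro mult_right_mono M') simp
      finally show False using m[OF seg] n[OF c] by linarith
    qed
  qed
qed

text \<open>A double zero makes |F| of order n^-2 at a nearby point of a grid with O(n^2) points;
  each such event has probability O(n^-4). Squares of growing half-side R exhaust the plane.\<close>

lemma AE_simple_zeros: "AE s in M. \<forall>z. H 0 z s = 0 \<longrightarrow> H 1 z s \<noteq> 0"
proof -
  have "AE s in M. \<forall>z\<in>cbox (- Complex R R) (Complex R R). H 0 z s = 0 \<longrightarrow> H 1 z s \<noteq> 0" if R: "R = real (Suc r)" for R r
  proof -
    let ?K = "cbox (- Complex R R) (Complex R R)"
    have R0: "R > 0" using R by simp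
    define pt where "pt n i = R * real_of_int i / real (Suc n)" for n i
    define C where "C n = (\<lambda>(i, j). Complex (pt n i) (pt n j)) ` ({- int (Suc n)..int (Suc n)} \<times> {- int (Suc n)..int (Suc n)})" for n
    have card: "card (C n) \<le> (2 * Suc n + 1)\<^sup>2" for n
    proof -
      have "card (C n) \<le> card ({- int (Suc n)..int (Suc n)} \<times> {- int (Suc n)..int (Suc n)})"
        unfolding C_def by (intro card_image_le) auto
      also have "card ({- int (Suc n)..int (Suc n)} \<times> {- int (Suc n)..int (Suc n)}) = (2 * Suc n + 1)\<^sup>2"
      proof -
        have "card {- int (Suc n)..int (Suc n)} = 2 * Suc n + 1" by (simp add: nat_eq_iff)
        then show ?thesis by (simp only: card_cartesian_product power2_eq_square)
      qed
      finally show ?thesis .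
    qed
    have pt: "\<bar>pt n i\<bar> \<le> R" if "i \<in> {- int (Suc n)..int (Suc n)}" for n i
    proof -
      have "\<bar>real_of_int i\<bar> \<le> real (Suc n)" using that by auto
      then show ?thesis using R0 unfolding pt_def by (simp add: abs_mult divide_le_eq mult_left_mono)
    qed
    have CK: "C n \<subseteq> ?K" for n
      using pt by (force simp: C_def in_cbox_complex_iff abs_le_iff)
    have "AE s in M. \<forall>m::nat. \<exists>n. \<forall>c\<in>C n. cmod (H 0 c s) > real m * (1 / real (Suc n))\<^sup>2"
    proof (rule AE_not_small_on_grids)
      show "compact ?K" by (rule compact_cbox)
      show "C n \<subseteq> ?K" for n by (rule CK)
      show "finite (C n)" for n unfolding C_def by simp
      have "(\<lambda>n. real ((2 * Suc n + 1)\<^sup>2) * ((1 / real (Suc n))\<^sup>2)\<^sup>2) \<longlonglongrightarrow> 0" by real_asymp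
      then show "(\<lambda>n. real (card (C n)) * ((1 / real (Suc n))\<^sup>2)\<^sup>2) \<longlonglongrightarrow> 0"
        by (rule Lim_null_comparison[rotated])
           (use card in \<open>auto intro!: always_eventually mult_right_mono simp del: of_nat_Suc of_nat_power of_nat_add of_nat_mult\<close>)
    qed simp
    with AE_good show ?thesis
    proof eventually_elim
      case (elim s)
      show ?case
      proof (intro ballI impI notI)
        fix z assume z: "z \<in> ?K" "H 0 z s = 0" "H 1 z s = 0"
        have "deriv (\<lambda>z. H 0 z s) z = 0" using z(3) by (simp add: good_deriv_eq[OF elim(1)])
        then obtain m :: nat where m: "\<And>w. w \<in> ?K \<Longrightarrow> cmod (H 0 w s) \<le> real m * (cmod (w - z))\<^sup>2"
          using entire_double_root_bound[OF good_holomorphic[OF elim(1)] z(2) _ compact_cbox] by blast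
        \<comment> \<open>Each coordinate of the chosen grid point is within R / (n + 1) of that of
          z, so the distance is at most 2 R / (n + 1).\<close>
        obtain M' :: nat where M': "real m * (2 * R)\<^sup>2 \<le> real M'" using real_arch_simple by blast
        obtain n where n: "\<And>c. c \<in> C n \<Longrightarrow> cmod (H 0 c s) > real M' * (1 / real (Suc n))\<^sup>2" using elim(2) by blast
        have ex: "\<exists>i\<in>{- int (Suc n)..int (Suc n)}. \<bar>pt n i - x\<bar> \<le> R / real (Suc n)" if "\<bar>x\<bar> \<le> R" for x
        proof -
          define y where "y = x * real (Suc n) / R"
          have x: "x = R * y / real (Suc n)" using R0 by (simp add: y_def)
          have y: "\<bar>y\<bar> \<le> real (Suc n)"
            using that R0 unfolding y_def by (simp add: abs_mult divide_le_eq mult_right_mono mult.commute del: of_nat_Suc)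
          have f: "\<bar>real_of_int \<lfloor>y\<rfloor> - y\<bar> \<le> 1" by linarith
          have "pt n \<lfloor>y\<rfloor> - x = R / real (Suc n) * (real_of_int \<lfloor>y\<rfloor> - y)"
            by (subst x) (simp add: pt_def right_diff_distrib del: of_nat_Suc)
          then have "\<bar>pt n \<lfloor>y\<rfloor> - x\<bar> = R / real (Suc n) * \<bar>real_of_int \<lfloor>y\<rfloor> - y\<bar>"
            using R0 by (simp add: abs_mult)
          also have "\<dots> \<le> R / real (Suc n)" using mult_left_mono[OF f, of "R / real (Suc n)"] R0 by (simp only: mult_1_right) simp
          finally have "\<bar>pt n \<lfloor>y\<rfloor> - x\<bar> \<le> R / real (Suc n)" .
          moreover have "\<lfloor>y\<rfloor> \<in> {- int (Suc n)..int (Suc n)}"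
            using y by (auto simp: le_floor_iff floor_le_iff abs_le_iff)
          ultimately show ?thesis by blast
        qed
        have "\<bar>Re z\<bar> \<le> R" "\<bar>Im z\<bar> \<le> R" using z(1) by (auto simp: in_cbox_complex_iff)
        then obtain i j where ij: "i \<in> {- int (Suc n)..int (Suc n)}" "\<bar>pt n i - Re z\<bar> \<le> R / real (Suc n)"
          "j \<in> {- int (Suc n)..int (Suc n)}" "\<bar>pt n j - Im z\<bar> \<le> R / real (Suc n)" using ex by meson
        define c where "c = Complex (pt n i) (pt n j)"
        have c: "c \<in> C n" unfolding C_def c_def
          by (rule image_eqI[of _ _ "(i, j)"]) (use ij in \<open>simp_all del: of_nat_Suc\<close>)
        have "cmod (c - z) \<le> 2 * R * (1 / real (Suc n))"
          using cmod_le[of "c - z"] ij by (simp add: c_def)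
        then have "(cmod (c - z))\<^sup>2 \<le> (2 * R * (1 / real (Suc n)))\<^sup>2" by (rule power_mono) simp
        then have "real m * (cmod (c - z))\<^sup>2 \<le> real m * ((2 * R)\<^sup>2 * (1 / real (Suc n))\<^sup>2)"
          unfolding power_mult_distrib by (rule mult_left_mono) simp
        also have "\<dots> \<le> real M' * (1 / real (Suc n))\<^sup>2"
          unfolding mult.assoc[symmetric] by (intro mult_right_mono M') simp
        finally show False using m[of c] CK c n[OF c] by fastforce
      qed
    qed
  qed
  then have "AE s in M. \<forall>r. \<forall>z\<in>cbox (- Complex (real (Suc r)) (real (Suc r))) (Complex (real (Suc r)) (real (Suc r))). H 0 z s = 0 \<longrightarrow> H 1 z s \<noteq> 0"
    unfolding AE_all_countable by blast
  then show ?thesis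
  proof eventually_elim
    case (elim s)
    show ?case
    proof (intro allI)
      fix z
      obtain r :: nat where r: "cmod z \<le> real r" using real_arch_simple by blast
      have "z \<in> cbox (- Complex (real (Suc r)) (real (Suc r))) (Complex (real (Suc r)) (real (Suc r)))"
        using r abs_Re_le_cmod[of z] abs_Im_le_cmod[of z] by (auto simp: in_cbox_complex_iff abs_le_iff)
      then show "H 0 z s = 0 \<longrightarrow> H 1 z s \<noteq> 0" using elim by blast
    qed
  qed
qed

end

section \<open>Expected number of zeros in a rectangle\<close>

context gauss_psd_noise
begin

text \<open>A version of \<open>H\<close> that is jointly measurable in \<open>z\<close> and the sample point.\<close>

definition Hs :: "nat \<Rightarrow> complex \<Rightarrow> 'a \<Rightarrow> complex" where
  "Hs k z s = (\<Sum>j. (2 * of_real pi * z) ^ j /\<^sub>R fact j * H (j + k) 0 s)"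

lemma good_Hs: "good s \<Longrightarrow> Hs k z s = H k z s"
  unfolding Hs_def good_def H_def by (rule sums_unique[symmetric, OF tempered_distribution_coherent_sums])

lemma Hs_measurable [measurable]: "(\<lambda>(z, s). Hs k z s) \<in> borel_measurable (borel \<Otimes>\<^sub>M M)"
  unfolding Hs_def by measurable

text \<open>The bound of \<open>nn_expectation_ratio_le\<close> for the residual, plus |drift|. Its
  role is to be continuous in z, hence bounded on segments.\<close>

definition ratio_bound :: "complex \<Rightarrow> real" where
  "ratio_bound z = 3 * (var z * sd\<^sup>2)\<^sup>2 + 1 + 64 / var z + cmod (drift z)"

lemma ratio_bound_continuous: "continuous_on A ratio_bound"
  unfolding ratio_bound_def[abs_def] drift_def Complex_eq using var_pos
  by (intro continuous_intros var_continuous) (auto simp: less_imp_neq[symmetric])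

lemma
  shows integrable_H_ratio: "integrable M (\<lambda>s. H 1 z s / H 0 z s)"
    and expectation_H_ratio: "expectation (\<lambda>s. H 1 z s / H 0 z s) = drift z"
    and expectation_norm_H_ratio: "expectation (\<lambda>s. cmod (H 1 z s / H 0 z s)) \<le> ratio_bound z"
proof -
  interpret circ_gauss_pair M "H 0 z" "\<lambda>s. H 1 z s - drift z * H 0 z s" "var z" "var z * sd\<^sup>2"
    by (rule circ_gauss_pair_H)
  let ?Q = "\<lambda>s. (H 1 z s - drift z * H 0 z s) / H 0 z s"
  have ae: "AE s in M. H 1 z s / H 0 z s = ?Q s + drift z"
    using AE_F_nonzero by eventually_elim (simp add: field_simps)
  have iQ: "integrable M (\<lambda>s. ?Q s + drift z)" using integrable_ratio by simp
  show int: "integrable M (\<lambda>s. H 1 z s / H 0 z s)"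
    using ae iQ by (subst integrable_cong_AE[OF _ _ ae]) auto
  have "expectation (\<lambda>s. H 1 z s / H 0 z s) = expectation (\<lambda>s. ?Q s + drift z)"
    using ae by (intro integral_cong_AE) auto
  also have "\<dots> = drift z"
    using integrable_ratio expectation_ratio by (simp add: prob_space)
  finally show "expectation (\<lambda>s. H 1 z s / H 0 z s) = drift z" .
  have nQ: "integrable M (\<lambda>s. cmod (?Q s))" using integrable_ratio by (rule integrable_norm)
  have eQ: "expectation (\<lambda>s. cmod (?Q s)) \<le> 3 * (var z * sd\<^sup>2)\<^sup>2 + 1 + 64 / var z"
  proof -
    have "ennreal (expectation (\<lambda>s. cmod (?Q s))) \<le> ennreal (3 * (var z * sd\<^sup>2)\<^sup>2 + 1 + 64 / var z)"
      using nn_expectation_ratio_le nQ by (subst nn_integral_eq_integral[symmetric]) auto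
    then show ?thesis using var_pos[of z] by (subst (asm) ennreal_le_iff) (auto intro!: add_nonneg_nonneg)
  qed
  have "expectation (\<lambda>s. cmod (H 1 z s / H 0 z s)) \<le> expectation (\<lambda>s. cmod (?Q s) + cmod (drift z))"
  proof (rule integral_mono_AE)
    show "integrable M (\<lambda>s. cmod (H 1 z s / H 0 z s))" using int by (rule integrable_norm)
    show "integrable M (\<lambda>s. cmod (?Q s) + cmod (drift z))" using nQ by simp
    show "AE s in M. cmod (H 1 z s / H 0 z s) \<le> cmod (?Q s) + cmod (drift z)"
      using ae by eventually_elim (simp only: norm_triangle_ineq)
  qed
  also have "\<dots> \<le> ratio_bound z" using eQ nQ by (simp add: prob_space ratio_bound_def)
  finally show "expectation (\<lambda>s. cmod (H 1 z s / H 0 z s)) \<le> ratio_bound z" .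
qed

text \<open>\<open>ratio_bound\<close> makes the integrand absolutely integrable over the segment
  and the sample space; \<open>Hs\<close> supplies the joint measurability, and for each fixed t it
  agrees with \<open>H\<close> almost surely.\<close>

lemma
  shows integrable_line_integral_ratio: "integrable M (\<lambda>s. line_integral p q (\<lambda>z. Hs 1 z s / Hs 0 z s))"
    and expectation_line_integral_ratio:
      "expectation (\<lambda>s. line_integral p q (\<lambda>z. Hs 1 z s / Hs 0 z s)) = line_integral p q drift"
proof -
  interpret P: pair_sigma_finite lborel M ..
  define f where "f t s = indicator {0..1} t *\<^sub>R (Hs 1 (linepath p q t) s / Hs 0 (linepath p q t) s * (q - p))" for t s
  have [measurable]: "linepath p q \<in> borel_measurable borel"
    by (intro borel_measurable_continuous_onI continuous_intros)
  have [measurable]: "case_prod f \<in> borel_measurable (lborel \<Otimes>\<^sub>M M)"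
    unfolding f_def by measurable
  have ae: "AE s in M. f t s = indicator {0..1} t *\<^sub>R (H 1 (linepath p q t) s / H 0 (linepath p q t) s * (q - p))" for t
    using AE_good by eventually_elim (simp add: f_def good_Hs)
  have intH: "integrable M (\<lambda>s. indicator {0..1} t *\<^sub>R (H 1 (linepath p q t) s / H 0 (linepath p q t) s * (q - p)))" for t
    using integrable_H_ratio by (intro integrable_scaleR_right integrable_mult_left)
  have intf: "integrable M (f t)" for t
    by (subst integrable_cong_AE[OF _ _ ae]) (use intH in auto)
  have "bounded (ratio_bound ` closed_segment p q)"
    by (intro compact_imp_bounded compact_continuous_image ratio_bound_continuous) simp
  then obtain B where B: "\<And>z. z \<in> closed_segment p q \<Longrightarrow> \<bar>ratio_bound z\<bar> \<le> B"
    unfolding bounded_iff by auto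
  have nf: "(LINT s|M. norm (f t s)) \<le> indicator {0..1} t * (B * cmod (q - p))" for t
  proof (cases "t \<in> {0..1}")
    case True
    have "(LINT s|M. norm (f t s)) = (LINT s|M. cmod (H 1 (linepath p q t) s / H 0 (linepath p q t) s) * cmod (q - p))"
    proof (rule integral_cong_AE)
      show "AE s in M. norm (f t s) = cmod (H 1 (linepath p q t) s / H 0 (linepath p q t) s) * cmod (q - p)"
        using ae[of t] by eventually_elim (use True in \<open>simp add: norm_mult norm_divide\<close>)
    qed auto
    also have "\<dots> \<le> B * cmod (q - p)"
      using order_trans[OF order_trans[OF expectation_norm_H_ratio abs_ge_self] B[OF linepath_in_path[OF True]]]
      by (subst integral_mult_left_zero) (intro mult_right_mono, auto)
    finally show ?thesis using True by simp
  qed (simp add: f_def)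
  have int: "integrable (lborel \<Otimes>\<^sub>M M) (case_prod f)"
  proof (rule P.Fubini_integrable)
    show "integrable lborel (\<lambda>t. LINT s|M. norm (case_prod f (t, s)))"
    proof (rule Bochner_Integration.integrable_bound)
      show "integrable lborel (\<lambda>t::real. indicator {0..1} t * (B * cmod (q - p)))"
        by (intro integrable_mult_left integrable_real_indicator) auto
      show "AE t in lborel. norm (LINT s|M. norm (case_prod f (t, s))) \<le> norm (indicator {0..1} t * (B * cmod (q - p)))"
        using order_trans[OF nf abs_ge_self] by (intro AE_I2) (simp add: integral_nonneg_AE)
    qed simp
    show "AE t in lborel. integrable M (\<lambda>s. case_prod f (t, s))" using intf by auto
  qed simp
  have line: "line_integral p q (\<lambda>z. Hs 1 z s / Hs 0 z s) = (LINT t|lborel. f t s)" for s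
    by (simp add: line_integral_def f_def)
  show "integrable M (\<lambda>s. line_integral p q (\<lambda>z. Hs 1 z s / Hs 0 z s))"
    unfolding line using P.integrable_snd[OF int] .
  have "expectation (\<lambda>s. line_integral p q (\<lambda>z. Hs 1 z s / Hs 0 z s)) = (LINT t|lborel. LINT s|M. f t s)"
    unfolding line by (rule P.Fubini_integral[OF int])
  also have "(\<lambda>t. LINT s|M. f t s) = (\<lambda>t. indicator {0..1} t *\<^sub>R (drift (linepath p q t) * (q - p)))"
  proof
    fix t
    have "(LINT s|M. f t s) = (LINT s|M. indicator {0..1} t *\<^sub>R (H 1 (linepath p q t) s / H 0 (linepath p q t) s * (q - p)))"
      using ae by (intro integral_cong_AE) auto
    then show "(LINT s|M. f t s) = indicator {0..1} t *\<^sub>R (drift (linepath p q t) * (q - p))"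
      using expectation_H_ratio[of "linepath p q t"] by (simp only: integral_scaleR_right integral_mult_left_zero)
  qed
  finally show "expectation (\<lambda>s. line_integral p q (\<lambda>z. Hs 1 z s / Hs 0 z s)) = line_integral p q drift"
    by (simp only: line_integral_def)
qed

text \<open>N is a measurable version of the zero count, whose own measurability is not known
  beforehand.\<close>

lemma box_zero_count:
  fixes p q :: complex
  assumes pq: "Re p < Re q" "Im p < Im q"
  obtains N :: "'a \<Rightarrow> real" where "integrable M N"
    "expectation N = (1 - \<beta>) * (Re q - Re p) * (Im q - Im p)"
    "AE s in M. finite {z \<in> box p q. H 0 z s = 0} \<and> N s = real (card {z \<in> box p q. H 0 z s = 0})"
proof
  \<comment> \<open>The logarithmic derivative of F is 2 pi H 1 / H 0, so the factor 2 pi cancels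
    against the argument principle: I is i times the count, and N its imaginary part.\<close>
  define I where "I s = rect_integral p q (\<lambda>z. Hs 1 z s / Hs 0 z s)" for s
  define N where "N s = Im (I s)" for s
  have intI: "integrable M I"
    unfolding I_def rect_integral_def by (intro Bochner_Integration.integrable_add integrable_line_integral_ratio)
  have "expectation I = rect_integral p q drift"
    unfolding I_def rect_integral_def
    by (simp only: Bochner_Integration.integral_add integrable_line_integral_ratio
        Bochner_Integration.integrable_add expectation_line_integral_ratio)
  then have "expectation I = \<i> * of_real ((1 - \<beta>) * (Re q - Re p) * (Im q - Im p))"
    unfolding drift_def rect_integral_affine .
  then show "expectation N = (1 - \<beta>) * (Re q - Re p) * (Im q - Im p)"
    unfolding N_def using Bochner_Integration.integral_Im[OF intI] by simp
  show "integrable M N" unfolding N_def using intI by (rule integrable_Im)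
  have "AE s in M. \<forall>z\<in>path_image (rectpath p q). H 0 z s \<noteq> 0"
    using AE_no_zero_on_segment[of p "Complex (Re q) (Im p)"] AE_no_zero_on_segment[of "Complex (Re q) (Im p)" q]
      AE_no_zero_on_segment[of q "Complex (Re p) (Im q)"] AE_no_zero_on_segment[of "Complex (Re p) (Im q)" p]
    by eventually_elim (auto simp: rectpath_def Let_def path_image_join)
  with AE_good AE_simple_zeros
  show "AE s in M. finite {z \<in> box p q. H 0 z s = 0} \<and> N s = real (card {z \<in> box p q. H 0 z s = 0})"
  proof eventually_elim
    case (elim s)
    note hol = good_holomorphic[OF elim(1)]
    have simple: "deriv (\<lambda>z. H 0 z s) z \<noteq> 0" if "H 0 z s = 0" for z
      using elim(2) that by (simp add: good_deriv_eq[OF elim(1)])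
    have nz: "H 0 z s \<noteq> 0" if "z \<in> path_image (rectpath p q)" for z using elim(3) that by blast
    note rect = contour_integral_rectpath_logderiv[OF hol pq nz simple]
    have cont: "continuous_on (path_image (rectpath p q)) (\<lambda>z. c * (H 1 z s / H 0 z s))" for c
      using hol[of 0] hol[of 1] nz
      by (intro continuous_intros) (auto intro: holomorphic_on_imp_continuous_on continuous_on_subset)
    have "contour_integral (rectpath p q) (\<lambda>z. deriv (\<lambda>z. H 0 z s) z / H 0 z s) =
        contour_integral (rectpath p q) (\<lambda>z. 2 * of_real pi * (H 1 z s / H 0 z s))"
      by (simp add: good_deriv_eq[OF elim(1)])
    also have "\<dots> = rect_integral p q (\<lambda>z. 2 * of_real pi * (H 1 z s / H 0 z s))"
      by (rule contour_integral_rectpath_eq_rect_integral[OF cont])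
    also have "\<dots> = 2 * of_real pi * I s"
    proof -
      have "line_integral u w (\<lambda>z. c * \<phi> z) = c * line_integral u w \<phi>" for u w c \<phi>
        unfolding line_integral_def by (subst integral_mult_right_zero[symmetric]) (simp add: mult_ac)
      then show ?thesis
        unfolding I_def rect_integral_def by (simp only: good_Hs[OF elim(1)] distrib_left)
    qed
    finally have "I s = \<i> * of_nat (card {z \<in> box p q. H 0 z s = 0})"
      using rect(2) by simp
    then show ?case using rect(1) by (simp add: N_def)
  qed
qed

end

section \<open>First intensity\<close>

text \<open>Preimages under f and g differ only inside a null set, and every subset of a null set is
  measurable in the completion.\<close>

lemma measurable_completion_AE:
  assumes g: "g \<in> borel_measurable (completion M)" and ae: "AE s in M. f s = g s"
  shows "f \<in> borel_measurable (completion M)"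
proof (rule measurableI)
  fix A :: "'b set" assume A: "A \<in> sets borel"
  obtain N where N: "N \<in> null_sets M" "{s \<in> space M. f s \<noteq> g s} \<subseteq> N"
    using ae by (auto elim!: AE_E simp: null_sets_def)
  have "f -` A \<inter> space M = (g -` A \<inter> space M - N) \<union> (f -` A \<inter> space M \<inter> N)" using N(2) by auto
  also have "\<dots> \<in> sets (completion M)"
  proof (rule sets.Un)
    show "g -` A \<inter> space M - N \<in> sets (completion M)"
      using measurable_sets[OF g A] N(1) by (intro sets.Diff) auto
    show "f -` A \<inter> space M \<inter> N \<in> sets (completion M)"
      using N(1) by (intro sets_completionI_sub[of N M]) auto
  qed
  finally show "f -` A \<inter> space (completion M) \<in> sets (completion M)" by simp
qed simp

lemma box_pair: "box A B = {fst A<..<fst B} \<times> {snd A<..<snd B}" for A B :: "real \<times> real"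
  by (auto simp: mem_box Basis_prod_def ball_Un inner_prod_def)

lemma emeasure_lborel_box_pair:
  fixes A B :: "real \<times> real"
  assumes "fst A \<le> fst B" "snd A \<le> snd B"
  shows "emeasure lborel (box A B) = ennreal ((fst B - fst A) * (snd B - snd A))"
proof -
  have "emeasure lborel (box A B) = emeasure (lborel \<Otimes>\<^sub>M lborel) ({fst A<..<fst B} \<times> {snd A<..<snd B})"
    by (simp add: lborel_prod box_pair)
  also have "\<dots> = ennreal ((fst B - fst A) * (snd B - snd A))"
    using assms by (subst lborel.emeasure_pair_measure_Times) (auto simp: ennreal_mult)
  finally show ?thesis .
qed

context gauss_psd_noise
begin

definition Z :: "'a \<Rightarrow> (real \<times> real) set" where
  "Z s = {(\<tau>, \<omega>). spectrogram (\<lambda>\<phi>. W \<phi> s) \<tau> \<omega> = 0}"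

lemma zero_count_eq: "zero_count W \<Omega> s = emeasure (count_space UNIV) (\<Omega> \<inter> Z s)"
  unfolding zero_count_def Z_def by (rule arg_cong[of _ _ "emeasure _"]) auto

lemma beta_less: "\<beta> < 1" "0 \<le> 1 - \<beta>"
  using denom_pos b_pos by (simp_all add: \<beta>_def field_simps)

text \<open>Boxes are arbitrary, possibly empty, because intersections of boxes occur in the Dynkin
  argument; almost sure finiteness is what permits subtraction there.\<close>

lemma zero_count_box:
  shows "zero_count W (box A B) \<in> borel_measurable (completion M)"
    and "(\<integral>\<^sup>+ s. zero_count W (box A B) s \<partial>completion M) = ennreal (1 - \<beta>) * emeasure lborel (box A B)"
    and "AE s in M. zero_count W (box A B) s < \<infinity>"
proof -
  have "zero_count W (box A B) \<in> borel_measurable (completion M) \<and>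
    (\<integral>\<^sup>+ s. zero_count W (box A B) s \<partial>completion M) = ennreal (1 - \<beta>) * emeasure lborel (box A B) \<and>
    (AE s in M. zero_count W (box A B) s < \<infinity>)"
  proof (cases "box A B = {}")
    case True
    have "zero_count W {} = (\<lambda>s. 0)" by (auto simp: zero_count_def fun_eq_iff)
    then show ?thesis unfolding True by simp
  next
    case False
    then have AB: "fst A < fst B" "snd A < snd B"
      by (auto simp: box_pair)
    \<comment> \<open>The map from (\<tau>, \<omega>) to \<tau> - i \<omega> reverses the second
      coordinate, so the upper bound of \<omega> gives the lower left corner.\<close>
    define p where "p = Complex (fst A) (- snd B)"
    define q where "q = Complex (fst B) (- snd A)"
    have "Re p < Re q" "Im p < Im q" using AB by (auto simp: p_def q_def)
    then obtain N :: "'a \<Rightarrow> real" where N: "integrable M N"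
      "expectation N = (1 - \<beta>) * (Re q - Re p) * (Im q - Im p)"
      "AE s in M. finite {z \<in> box p q. H 0 z s = 0} \<and> N s = real (card {z \<in> box p q. H 0 z s = 0})"
      by (rule box_zero_count)
    have ae: "AE s in M. zero_count W (box A B) s = ennreal (N s) \<and> 0 \<le> N s"
      using N(3) AE_good
    proof eventually_elim
      case (elim s)
      have "bij_betw (\<lambda>(\<tau>, \<omega>). Complex \<tau> (- \<omega>)) (box A B \<inter> Z s) {z \<in> box p q. H 0 z s = 0}"
      proof (rule bij_betwI[where g = "\<lambda>z. (Re z, - Im z)"])
        show "(\<lambda>(\<tau>, \<omega>). Complex \<tau> (- \<omega>)) \<in> box A B \<inter> Z s \<rightarrow> {z \<in> box p q. H 0 z s = 0}"
          using elim(2) unfolding good_def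
          by (auto simp: Z_def H_def spectrogram_eq_0_iff in_box_complex_iff p_def q_def box_pair)
        show "(\<lambda>z. (Re z, - Im z)) \<in> {z \<in> box p q. H 0 z s = 0} \<rightarrow> box A B \<inter> Z s"
          using elim(2) unfolding good_def
          by (auto simp: Z_def H_def spectrogram_eq_0_iff in_box_complex_iff p_def q_def box_pair)
      qed auto
      then have "card (box A B \<inter> Z s) = card {z \<in> box p q. H 0 z s = 0}" "finite (box A B \<inter> Z s)"
        using elim(1) by (auto simp: bij_betw_same_card bij_betw_finite)
      then show ?case using elim(1) by (simp add: zero_count_eq ennreal_of_nat_eq_real_of_nat)
    qed
    have meas: "zero_count W (box A B) \<in> borel_measurable (completion M)"
      by (rule measurable_completion_AE[where g = "\<lambda>s. ennreal (N s)"])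
         (use N(1) ae in \<open>auto intro!: measurable_completion elim: eventually_mono\<close>)
    have "(\<integral>\<^sup>+ s. zero_count W (box A B) s \<partial>completion M) = (\<integral>\<^sup>+ s. ennreal (N s) \<partial>completion M)"
      by (rule nn_integral_cong_AE) (use AE_completion[OF ae] in \<open>auto elim: eventually_mono\<close>)
    also have "\<dots> = (\<integral>\<^sup>+ s. ennreal (N s) \<partial>M)"
      by (rule nn_integral_completion)
    also have "\<dots> = ennreal (expectation N)"
      using ae by (intro nn_integral_eq_integral N(1)) (auto elim: eventually_mono)
    also have "\<dots> = ennreal (1 - \<beta>) * emeasure lborel (box A B)"
      using AB beta_less by (simp add: N(2) emeasure_lborel_box_pair p_def q_def ennreal_mult mult.assoc)
    finally have int: "(\<integral>\<^sup>+ s. zero_count W (box A B) s \<partial>completion M) = ennreal (1 - \<beta>) * emeasure lborel (box A B)" .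
    have "AE s in M. zero_count W (box A B) s < \<infinity>" using ae by eventually_elim simp
    with meas int show ?thesis by blast
  qed
  then show "zero_count W (box A B) \<in> borel_measurable (completion M)"
    "(\<integral>\<^sup>+ s. zero_count W (box A B) s \<partial>completion M) = ennreal (1 - \<beta>) * emeasure lborel (box A B)"
    "AE s in M. zero_count W (box A B) s < \<infinity>" by blast+
qed

text \<open>Localizing to a fixed box keeps the count almost surely finite and the area finite, so
  complements can be handled by subtraction; disjoint unions are countable additivity of the
  counting measure.\<close>

lemma zero_count_Borel_inter_box:
  assumes "\<Omega> \<in> sets borel"
  shows "zero_count W (\<Omega> \<inter> box A B) \<in> borel_measurable (completion M) \<and>
    (\<integral>\<^sup>+ s. zero_count W (\<Omega> \<inter> box A B) s \<partial>completion M) = ennreal (1 - \<beta>) * emeasure lborel (\<Omega> \<inter> box A B)"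
proof -
  have \<Omega>: "\<Omega> \<in> sigma_sets UNIV (range (\<lambda>(a, b). box a b))"
    using assms by (simp add: borel_eq_box)
  have istab: "Int_stable (range (\<lambda>(a, b). box a b) :: (real \<times> real) set set)"
    unfolding Int_stable_def by (auto simp: box_Int_box)
  have sub: "range (\<lambda>(a, b). box a b) \<subseteq> Pow (UNIV :: (real \<times> real) set)" by simp
  have borel: "X \<in> sets borel" if "X \<in> sigma_sets UNIV (range (\<lambda>(a, b). box a b))" for X :: "(real \<times> real) set"
    using that by (simp add: borel_eq_box)
  show ?thesis
    using istab sub \<Omega>
  proof (induction rule: sigma_sets_induct_disjoint)
    case (basic X)
    then obtain a b where X: "X = box a b" by auto
    obtain c d where "box a b \<inter> box A B = box c d"
      unfolding box_Int_box by blast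
    then show ?case unfolding X using zero_count_box by simp
  next
    case empty
    have "zero_count W {} = (\<lambda>s. 0)" by (auto simp: zero_count_def fun_eq_iff)
    then show ?case by simp
  next
    case (compl X)
    have eq: "(UNIV - X) \<inter> box A B = box A B - X \<inter> box A B" by auto
    have add: "zero_count W (box A B) s = zero_count W (X \<inter> box A B) s + zero_count W ((UNIV - X) \<inter> box A B) s" for s
    proof -
      have "box A B \<inter> Z s = (X \<inter> box A B \<inter> Z s) \<union> ((UNIV - X) \<inter> box A B \<inter> Z s)" by auto
      then show ?thesis unfolding zero_count_eq by (subst plus_emeasure) auto
    qed
    have ae: "AE s in M. zero_count W ((UNIV - X) \<inter> box A B) s = zero_count W (box A B) s - zero_count W (X \<inter> box A B) s"
      using zero_count_box(3)[of A B] by eventually_elim (simp add: add ennreal_add_diff_cancel_left less_top)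
    have m: "(\<lambda>s. zero_count W (box A B) s - zero_count W (X \<inter> box A B) s) \<in> borel_measurable (completion M)"
      using zero_count_box(1) compl by (intro borel_measurable_minus_ennreal) auto
    have meas: "zero_count W ((UNIV - X) \<inter> box A B) \<in> borel_measurable (completion M)"
      using m ae by (rule measurable_completion_AE)
    have finL: "emeasure lborel (X \<inter> box A B) < \<infinity>"
      using emeasure_bounded_finite[OF bounded_box, of A B] emeasure_mono[of "X \<inter> box A B" "box A B" lborel]
      by (simp add: le_less_trans)
    have "(\<integral>\<^sup>+ s. zero_count W ((UNIV - X) \<inter> box A B) s \<partial>completion M) =
       (\<integral>\<^sup>+ s. zero_count W (box A B) s - zero_count W (X \<inter> box A B) s \<partial>completion M)"
      by (rule nn_integral_cong_AE[OF AE_completion[OF ae]])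
    also have "\<dots> = (\<integral>\<^sup>+ s. zero_count W (box A B) s \<partial>completion M) - (\<integral>\<^sup>+ s. zero_count W (X \<inter> box A B) s \<partial>completion M)"
    proof (rule nn_integral_diff)
      show "(\<integral>\<^sup>+ s. zero_count W (X \<inter> box A B) s \<partial>completion M) \<noteq> \<infinity>"
        using compl finL by (simp add: ennreal_mult_eq_top_iff less_top)
      show "zero_count W (box A B) \<in> borel_measurable (completion M)" by (rule zero_count_box(1))
      show "zero_count W (X \<inter> box A B) \<in> borel_measurable (completion M)" using compl by blast
      show "AE s in completion M. zero_count W (X \<inter> box A B) s \<le> zero_count W (box A B) s"
        by (rule AE_I2) (simp only: add le_iff_add, blast)
    qed
    also have "\<dots> = ennreal (1 - \<beta>) * emeasure lborel (box A B) - ennreal (1 - \<beta>) * emeasure lborel (X \<inter> box A B)"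
      using zero_count_box(2) compl by simp
    also have "\<dots> = ennreal (1 - \<beta>) * (emeasure lborel (box A B) - emeasure lborel (X \<inter> box A B))"
      by (simp add: ennreal_right_diff_distrib)
    also have "emeasure lborel (box A B) - emeasure lborel (X \<inter> box A B) = emeasure lborel ((UNIV - X) \<inter> box A B)"
      unfolding eq using finL borel[OF compl(1)] by (subst emeasure_Diff) auto
    finally show ?case using meas by simp
  next
    case (union X)
    have sums: "zero_count W ((\<Union>i. X i) \<inter> box A B) s = (\<Sum>i. zero_count W (X i \<inter> box A B) s)" for s
    proof -
      have "disjoint_family (\<lambda>i. X i \<inter> box A B \<inter> Z s)"
        using union(1) by (auto simp: disjoint_family_on_def)
      then have "(\<Sum>i. emeasure (count_space UNIV) (X i \<inter> box A B \<inter> Z s)) = emeasure (count_space UNIV) (\<Union>i. X i \<inter> box A B \<inter> Z s)"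
        by (intro suminf_emeasure) auto
      moreover have "(\<Union>i. X i \<inter> box A B \<inter> Z s) = (\<Union>i. X i) \<inter> box A B \<inter> Z s" by auto
      ultimately show ?thesis by (simp add: zero_count_eq)
    qed
    have m: "zero_count W (X i \<inter> box A B) \<in> borel_measurable (completion M)" for i using union by blast
    have "(\<integral>\<^sup>+ s. zero_count W ((\<Union>i. X i) \<inter> box A B) s \<partial>completion M) =
        (\<Sum>i. \<integral>\<^sup>+ s. zero_count W (X i \<inter> box A B) s \<partial>completion M)"
      unfolding sums by (rule nn_integral_suminf[OF m])
    also have "\<dots> = (\<Sum>i. ennreal (1 - \<beta>) * emeasure lborel (X i \<inter> box A B))" using union by simp
    also have "\<dots> = ennreal (1 - \<beta>) * (\<Sum>i. emeasure lborel (X i \<inter> box A B))" by (rule ennreal_suminf_cmult)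
    also have "(\<Sum>i. emeasure lborel (X i \<inter> box A B)) = emeasure lborel (\<Union>i. X i \<inter> box A B)"
      using union borel by (intro suminf_emeasure) (auto simp: disjoint_family_on_def)
    finally have "(\<integral>\<^sup>+ s. zero_count W ((\<Union>i. X i) \<inter> box A B) s \<partial>completion M) =
        ennreal (1 - \<beta>) * emeasure lborel ((\<Union>i. X i) \<inter> box A B)" by (simp add: UN_simps)
    moreover have "zero_count W ((\<Union>i. X i) \<inter> box A B) \<in> borel_measurable (completion M)"
      unfolding sums[abs_def] using m by measurable
    ultimately show ?case by blast
  qed
qed

text \<open>Boxes growing to the plane remove the localization by monotone convergence, which also
  covers sets of infinite area.\<close>

lemma first_intensity: "first_intensity_spec M W (\<lambda>\<tau> \<omega>. 1 - \<beta>)"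
  unfolding first_intensity_spec_def
proof (intro conjI ballI allI)
  show "(\<lambda>(\<tau>, \<omega>). 1 - \<beta>) \<in> borel_measurable borel" by simp
  show "0 \<le> 1 - \<beta>" using beta_less by simp
  fix \<Omega> :: "(real \<times> real) set" assume \<Omega>: "\<Omega> \<in> sets borel"
  define B where "B k = box (- real k, - real k) (real k, real k)" for k :: nat
  have inc: "incseq B" unfolding B_def by (intro incseq_SucI) (auto simp: box_pair)
  have UB: "(\<Union>k. B k) = UNIV"
  proof (intro set_eqI iffI UNIV_I)
    fix p :: "real \<times> real"
    obtain k :: nat where "\<bar>fst p\<bar> + \<bar>snd p\<bar> < real k" using reals_Archimedean2 by blast
    then have "p \<in> B k" by (cases p) (auto simp: B_def box_pair)
    then show "p \<in> (\<Union>k. B k)" by blast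
  qed
  \<comment> \<open>Stated for any measure because it serves twice: for the counting measure of the
    zeros and for Lebesgue measure.\<close>
  have sup: "emeasure \<mu> X = (SUP k. emeasure \<mu> (X \<inter> B k))" if "\<And>k. X \<inter> B k \<in> sets \<mu>" for \<mu> X
  proof -
    have "(SUP k. emeasure \<mu> (X \<inter> B k)) = emeasure \<mu> (\<Union>k. X \<inter> B k)"
      using inc that by (intro SUP_emeasure_incseq) (auto simp: incseq_def)
    also have "(\<Union>k. X \<inter> B k) = X" using UB by auto
    finally show ?thesis ..
  qed
  have zsup: "zero_count W \<Omega> s = (SUP k. zero_count W (\<Omega> \<inter> B k) s)" for s
    unfolding zero_count_eq by (subst sup) (auto simp: Int_ac)
  have m: "zero_count W (\<Omega> \<inter> B k) \<in> borel_measurable (completion M)"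
    and i: "(\<integral>\<^sup>+ s. zero_count W (\<Omega> \<inter> B k) s \<partial>completion M) = ennreal (1 - \<beta>) * emeasure lborel (\<Omega> \<inter> B k)" for k
    unfolding B_def using zero_count_Borel_inter_box[OF \<Omega>] by blast+
  show "zero_count W \<Omega> \<in> borel_measurable (completion M)"
    unfolding zsup[abs_def] using m by measurable
  have "(\<integral>\<^sup>+ s. zero_count W \<Omega> s \<partial>completion M) = (SUP k. \<integral>\<^sup>+ s. zero_count W (\<Omega> \<inter> B k) s \<partial>completion M)"
    unfolding zsup
  proof (rule nn_integral_monotone_convergence_SUP)
    show "incseq (\<lambda>k s. zero_count W (\<Omega> \<inter> B k) s)"
      using inc by (auto simp: incseq_def le_fun_def zero_count_eq intro!: emeasure_mono)
  qed (rule m)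
  also have "\<dots> = ennreal (1 - \<beta>) * (SUP k. emeasure lborel (\<Omega> \<inter> B k))"
    unfolding i by (rule SUP_mult_left_ennreal[symmetric])
  also have "(SUP k. emeasure lborel (\<Omega> \<inter> B k)) = emeasure lborel \<Omega>"
    using \<Omega> by (intro sup[symmetric]) (auto simp: B_def)
  also have "ennreal (1 - \<beta>) * emeasure lborel \<Omega> = (\<integral>\<^sup>+ (\<tau>, \<omega>) \<in> \<Omega>. ennreal (1 - \<beta>) \<partial>lborel)"
    using \<Omega> by (simp add: case_prod_unfold nn_integral_cmult_indicator)
  finally show "(\<integral>\<^sup>+ s. zero_count W \<Omega> s \<partial>completion M) = (\<integral>\<^sup>+ (\<tau>, \<omega>) \<in> \<Omega>. ennreal (1 - \<beta>) \<partial>lborel)" .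
qed

end

theorem proposition1p3:
  fixes M :: "'a measure"
    and W :: "(real \<Rightarrow> complex) \<Rightarrow> 'a \<Rightarrow> complex"
    and b :: real
  assumes "b > 0"
    and "psd_noise M W (\<lambda>\<omega>. exp (- b * \<omega>\<^sup>2))"
  shows "first_intensity_spec M W (\<lambda>\<tau> \<omega>. 2 * pi / (2 * pi + b))"
proof -
  interpret gauss_psd_noise M W b
    using assms by (simp add: gauss_psd_noise_def gauss_psd_noise_axioms_def)
  have "1 - \<beta> = 2 * pi / (2 * pi + b)"
    using denom_pos by (simp add: \<beta>_def field_simps)
  then show ?thesis using first_intensity by simp
qed

end
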